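(* Let $\mathcal M^a_{d,h}=(Q,H^a_{d,h},\phi^a_{d,h})$, $a=1,2$, be two smooth $1$-parameter families of forced discrete Hamiltonian systems such that their forced discrete Legendre transforms $\mathbb F^{\pm}_{\phi^a_{d,h}}H^a_{d,h}$ ($a=1,2$) are diffeomorphisms of $T^*Q$ when $h=0$. Let $r\in\mathbb N$. If $\mathcal M^2_{d,h}=\mathcal M^1_{d,h}+\mathcal O(h^{r+1})$, then the corresponding discrete flows have contact of order $r$, that is, $$\mathbf F^{\mathcal M^2_{d,h}}=\mathbf F^{\mathcal M^1_{d,h}}+\mathcal O(h^{r+1}).$$
   Context: $Q$ is a finite-dimensional real vector space and $T^*Q\simeq Q\times Q^*$. A forced discrete Hamiltonian system (FDHS) is a triple $(Q,H_d,\phi_d)$ with $H_d:T^*Q\to\mathbb R$ smooth and $\phi_d$ a smooth 1-form on $T^*Q$, decomposed as $\phi_d(q,p)(\delta q,\delta p)=\phi_d^q(q,p)(\delta q)+\phi_d^p(q,p)(\delta p)$. Its forced discrete Legendre transforms $T^*Q\to T^*Q$ are $$\mathbb F^+_{\phi_d}H_d(q_0,p_1)=(D_2H_d(q_0,p_1)-\phi_d^p(q_0,p_1),\,p_1),\qquad \mathbb F^-_{\phi_d}H_d(q_0,p_1)=(q_0,\,D_1H_d(q_0,p_1)-\phi_d^q(q_0,p_1)).$$ A smooth 1-parameter family $(Q,H_{d,h},\phi_{d,h})$ is one where $H_{d,h}(q,p)$ and $\phi_{d,h}(q,p)$ are smooth in $(q,p,h)$ on an open neighborhood of $T^*Q\times\{0\}$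 in $T^*Q\times\mathbb R$. Discrete flow: $\mathbf F^{\mathcal M_{d,h}}=(\mathbb F^+_{\phi_{d,h}}H_{d,h})\circ(\mathbb F^-_{\phi_{d,h}}H_{d,h})^{-1}$. Since $\mathbb F^-_{\phi_{d,h}}H_{d,h}$ is a diffeomorphism at $h=0$, the map $(x,h)\mapsto(\mathbb F^-_{\phi_{d,h}}H_{d,h}(x),h)$ restricts to a diffeomorphism between open neighborhoods of $T^*Q\times\{0\}$ in $T^*Q\times\mathbb R$; the inverse is taken there, so the flow is a smooth map of $(x,h)$ on an open neighborhood of $T^*Q\times\{0\}$ with values in $T^*Q$. Contact order: for smooth maps $f_1,f_2$ defined on open neighborhoods $\mathcal W_1,\mathcal W_2$ of $X\times\{0\}$ in $X\times\mathbb R$ ($X$ a finite-dimensional real vector space) with values in a finite-dimensional real vector space $Y$, $f_2=f_1+\mathcal O(h^{r+1})$ (contact of order $r$) means that there are an open $U\subset\mathcal W_1\cap\mathcal W_2$ containing $X\times\{0\}$ and a continuous $\delta f:U\to Y$ with $f_2(x,h)-f_1(x,h)=h^{r+1}\delta f(x,h)$ on $U$. For families of FDHSs, $\mathcal M^2_{d,h}=\mathcal M^1_{d,h}+\mathcal O(h^{r+1})$ means $H^2_{d,h}=H^1_{d,h}+\mathcal O(h^{r+1})$ and $\phi^2_{d,h}=\phi^1_{d,h}+\mathcal O(h^{r+1})$, where 1-forms are viewed as maps to $(Q\times Q^* )^*$. *)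

theory Defs
  imports "HOL-Analysis.Analysis"
begin

section \<open>Smooth maps, diffeomorphisms and contact order\<close>

text \<open>
  The domain \<open>S\<close> is meant to be an open subset of a finite-dimensional space. There, a map all of
  whose directional derivatives \<open>x \<mapsto> Df(x)v\<close> are of class \<open>C^k\<close> has a derivative of class \<open>C^k\<close>,
  so the recursion describes the usual class \<open>C^k\<close> without iterating spaces of linear maps.
\<close>

fun Ck_on :: "nat \<Rightarrow> 'x set \<Rightarrow> ('x::real_normed_vector \<Rightarrow> 'y::real_normed_vector) \<Rightarrow> bool" where
  "Ck_on 0 S f \<longleftrightarrow> continuous_on S f"
| "Ck_on (Suc k) S f \<longleftrightarrow>
     (\<forall>x\<in>S. f differentiable (at x)) \<and> (\<forall>v. Ck_on k S (\<lambda>x. frechet_derivative f (at x) v))"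

definition smooth_on :: "'x set \<Rightarrow> ('x::real_normed_vector \<Rightarrow> 'y::real_normed_vector) \<Rightarrow> bool" where
  "smooth_on S f \<longleftrightarrow> (\<forall>k. Ck_on k S f)"

definition diffeo_between ::
  "'x set \<Rightarrow> 'y set \<Rightarrow> ('x::real_normed_vector \<Rightarrow> 'y::real_normed_vector) \<Rightarrow> bool" where
  "diffeo_between U V f \<longleftrightarrow>
     open U \<and> open V \<and> bij_betw f U V \<and> smooth_on U f \<and> smooth_on V (inv_into U f)"

text \<open>
  \<open>f1\<close> and \<open>f2\<close> are only meaningful on the neighbourhoods \<open>W1\<close> and \<open>W2\<close> of \<open>X \<times> {0}\<close>. The parameter
  \<open>h\<close> is the second component of the argument.
\<close>

definition contact_order ::
  "nat \<Rightarrow> ('x::real_normed_vector \<times> real) set \<Rightarrow> ('x \<times> real \<Rightarrow> 'y::real_normed_vector) \<Rightarrow>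
   ('x \<times> real) set \<Rightarrow> ('x \<times> real \<Rightarrow> 'y) \<Rightarrow> bool" where
  "contact_order r W1 f1 W2 f2 \<longleftrightarrow>
     (\<exists>U df. open U \<and> UNIV \<times> {0} \<subseteq> U \<and> U \<subseteq> W1 \<inter> W2 \<and> continuous_on U df \<and>
        (\<forall>x h. (x, h) \<in> U \<longrightarrow> f2 (x, h) - f1 (x, h) = h ^ (r + 1) *\<^sub>R df (x, h)))"


section \<open>Forced discrete Hamiltonian systems\<close>

text \<open>
  The configuration space is the type \<open>'a\<close>; its inner product is used only for its topology, and
  covectors are kept distinct from vectors.
\<close>

type_synonym 'a dual = "'a \<Rightarrow>\<^sub>L real"

type_synonym 'a cotangent = "'a \<times> ('a \<Rightarrow>\<^sub>L real)"

text \<open>The canonical identification of the bidual \<open>Q**\<close> with \<open>Q\<close>.\<close>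

definition of_bidual :: "'a::euclidean_space dual dual \<Rightarrow> 'a" where
  "of_bidual L = (THE q. \<forall>\<alpha>. blinfun_apply L \<alpha> = blinfun_apply \<alpha> q)"

lemma of_bidual:
  fixes L :: "'a::euclidean_space dual dual"
  shows "blinfun_apply \<alpha> (of_bidual L) = blinfun_apply L \<alpha>"
proof -
  define q where "q = (\<Sum>b\<in>Basis. blinfun_apply L (blinfun_inner_left b) *\<^sub>R b)"
  have ex: "blinfun_apply L \<beta> = blinfun_apply \<beta> q" for \<beta>
  proof -
    have "\<beta> = (\<Sum>b\<in>Basis. blinfun_apply \<beta> b *\<^sub>R blinfun_inner_left b)"
    proof (rule blinfun_eqI)
      fix x :: 'a
      have "blinfun_apply \<beta> x = blinfun_apply \<beta> (\<Sum>b\<in>Basis. (x \<bullet> b) *\<^sub>R b)"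
        by (simp add: euclidean_representation)
      also have "\<dots> = blinfun_apply (\<Sum>b\<in>Basis. blinfun_apply \<beta> b *\<^sub>R blinfun_inner_left b) x"
        by (simp add: blinfun.sum_right blinfun.scaleR_right blinfun.sum_left blinfun.scaleR_left
            mult.commute inner_commute)
      finally show "blinfun_apply \<beta> x
          = blinfun_apply (\<Sum>b\<in>Basis. blinfun_apply \<beta> b *\<^sub>R blinfun_inner_left b) x" .
    qed
    then have "blinfun_apply L \<beta>
        = blinfun_apply L (\<Sum>b\<in>Basis. blinfun_apply \<beta> b *\<^sub>R blinfun_inner_left b)"
      by simp
    also have "\<dots> = blinfun_apply \<beta> q"
      by (simp add: q_def blinfun.sum_right blinfun.scaleR_right mult.commute)
    finally show ?thesis .
  qed
  have uniq: "q' = q" if "\<forall>\<beta>. blinfun_apply L \<beta> = blinfun_apply \<beta> q'" for q'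
  proof (rule euclidean_eqI)
    fix b :: 'a
    have "blinfun_apply (blinfun_inner_left b) q' = blinfun_apply (blinfun_inner_left b) q"
      using that ex by metis
    then show "q' \<bullet> b = q \<bullet> b"
      by (simp add: inner_commute)
  qed
  have "\<forall>\<beta>. blinfun_apply L \<beta> = blinfun_apply \<beta> (of_bidual L)"
    unfolding of_bidual_def by (rule theI[of _ q]) (use ex uniq in auto)
  then show ?thesis by simp
qed

text \<open>
  Partial derivatives of \<open>H\<close> and the two parts of a 1-form \<open>\<phi>\<close> on the cotangent space. \<open>Blinfun\<close> only
  repackages a linear map as an element of the dual space.
\<close>

definition D1 :: "('a::euclidean_space cotangent \<Rightarrow> real) \<Rightarrow> 'a cotangent \<Rightarrow> 'a dual" where
  "D1 H z = Blinfun (frechet_derivative (\<lambda>q. H (q, snd z)) (at (fst z)))"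

definition D2 :: "('a::euclidean_space cotangent \<Rightarrow> real) \<Rightarrow> 'a cotangent \<Rightarrow> 'a dual dual" where
  "D2 H z = Blinfun (frechet_derivative (\<lambda>p. H (fst z, p)) (at (snd z)))"

definition form_q ::
  "('a::euclidean_space cotangent \<Rightarrow> 'a cotangent dual) \<Rightarrow> 'a cotangent \<Rightarrow> 'a dual" where
  "form_q \<phi> z = Blinfun (\<lambda>dq. blinfun_apply (\<phi> z) (dq, 0))"

definition form_p ::
  "('a::euclidean_space cotangent \<Rightarrow> 'a cotangent dual) \<Rightarrow> 'a cotangent \<Rightarrow> 'a dual dual" where
  "form_p \<phi> z = Blinfun (\<lambda>dp. blinfun_apply (\<phi> z) (0, dp))"

definition legendre_plus ::
  "('a::euclidean_space cotangent \<Rightarrow> real) \<Rightarrow> ('a cotangent \<Rightarrow> 'a cotangent dual) \<Rightarrow>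
   'a cotangent \<Rightarrow> 'a cotangent" where
  "legendre_plus H \<phi> z = (of_bidual (D2 H z - form_p \<phi> z), snd z)"

definition legendre_minus ::
  "('a::euclidean_space cotangent \<Rightarrow> real) \<Rightarrow> ('a cotangent \<Rightarrow> 'a cotangent dual) \<Rightarrow>
   'a cotangent \<Rightarrow> 'a cotangent" where
  "legendre_minus H \<phi> z = (fst z, D1 H z - form_q \<phi> z)"


section \<open>One-parameter families and their discrete flows\<close>

text \<open>
  \<open>ham (z, h)\<close> and \<open>force (z, h)\<close> stand for \<open>H\<^sub>d\<^sub>,\<^sub>h z\<close> and \<open>\<phi>\<^sub>d\<^sub>,\<^sub>h z\<close>; their values outside \<open>fdom\<close>
  carry no meaning.
\<close>

record (overloaded) 'a fdhs_family =
  fdom :: "('a cotangent \<times> real) set"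
  ham :: "'a cotangent \<times> real \<Rightarrow> real"
  force :: "'a cotangent \<times> real \<Rightarrow> 'a cotangent dual"

definition smooth_fdhs_family :: "'a::euclidean_space fdhs_family \<Rightarrow> bool" where
  "smooth_fdhs_family M \<longleftrightarrow>
     open (fdom M) \<and> UNIV \<times> {0} \<subseteq> fdom M \<and>
     smooth_on (fdom M) (ham M) \<and> smooth_on (fdom M) (force M)"

definition fdhs_contact_order ::
  "nat \<Rightarrow> 'a::euclidean_space fdhs_family \<Rightarrow> 'a fdhs_family \<Rightarrow> bool" where
  "fdhs_contact_order r M1 M2 \<longleftrightarrow>
     contact_order r (fdom M1) (ham M1) (fdom M2) (ham M2) \<and>
     contact_order r (fdom M1) (force M1) (fdom M2) (force M2)"

definition fam_legendre_plus ::
  "'a::euclidean_space fdhs_family \<Rightarrow> real \<Rightarrow> 'a cotangent \<Rightarrow> 'a cotangent" where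
  "fam_legendre_plus M h = legendre_plus (\<lambda>z. ham M (z, h)) (\<lambda>z. force M (z, h))"

definition fam_legendre_minus ::
  "'a::euclidean_space fdhs_family \<Rightarrow> real \<Rightarrow> 'a cotangent \<Rightarrow> 'a cotangent" where
  "fam_legendre_minus M h = legendre_minus (\<lambda>z. ham M (z, h)) (\<lambda>z. force M (z, h))"

definition lifted_minus ::
  "'a::euclidean_space fdhs_family \<Rightarrow> 'a cotangent \<times> real \<Rightarrow> 'a cotangent \<times> real" where
  "lifted_minus M = (\<lambda>(z, h). (fam_legendre_minus M h z, h))"

text \<open>
  The inverse of the minus Legendre transform depends on the neighbourhood \<open>U\<close> on which
  \<open>lifted_minus M\<close> is inverted. The flow is therefore indexed by \<open>U\<close>; it is meaningful on
  \<open>flow_dom M U\<close>, and two choices of \<open>U\<close> give the same flow near \<open>h = 0\<close>.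
\<close>

definition inversion_nbhd ::
  "'a::euclidean_space fdhs_family \<Rightarrow> ('a cotangent \<times> real) set \<Rightarrow> bool" where
  "inversion_nbhd M U \<longleftrightarrow>
     UNIV \<times> {0} \<subseteq> U \<and> U \<subseteq> fdom M \<and> UNIV \<times> {0} \<subseteq> lifted_minus M ` U \<and>
     diffeo_between U (lifted_minus M ` U) (lifted_minus M)"

definition flow_dom ::
  "'a::euclidean_space fdhs_family \<Rightarrow> ('a cotangent \<times> real) set \<Rightarrow> ('a cotangent \<times> real) set" where
  "flow_dom M U = lifted_minus M ` U"

definition discrete_flow ::
  "'a::euclidean_space fdhs_family \<Rightarrow> ('a cotangent \<times> real) set \<Rightarrow>
   'a cotangent \<times> real \<Rightarrow> 'a cotangent" where
  "discrete_flow M U = (\<lambda>(z, h). fam_legendre_plus M h (fst (inv_into U (lifted_minus M) (z, h))))"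

end

theory Submission
  imports Defs
begin

text \<open>
  For smooth \<open>f1\<close>, \<open>f2\<close>, contact of order \<open>r\<close> means that \<open>(f2 - f1) / h^(r+1)\<close> has a limit at every
  \<open>(x, 0)\<close>. By Taylor's formula in \<open>h\<close> this property passes from \<open>H\<close> to its derivatives along the
  cotangent space, hence to the Legendre transforms. Write \<open>L1\<close>, \<open>L2\<close> for the lifted minus transforms,
  \<open>K1\<close>, \<open>K2\<close> for their inverses and \<open>p1\<close>, \<open>p2\<close> for the plus transforms. The difference of the flows is
  \<open>(p2 - p1) (K2 w) + (q (L1 (K2 w)) - q w)\<close> with \<open>q = p1 \<circ> K1\<close>. The first term is of order
  \<open>h^(r+1)\<close> by contact of the plus transforms; so is \<open>L1 (K2 w) - w = (L1 - L2) (K2 w)\<close>, and strict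
  differentiability of \<open>q\<close> handles the second term.
\<close>

section \<open>Linear functionals as a Euclidean space\<close>

text \<open>The contact factor of \<open>H\<close> is only continuous, so it cannot be
  differentiated to reach the Legendre transforms. Joint smoothness in \<open>(x, h)\<close> helps
  instead: a nonzero Taylor coefficient in \<open>h\<close> of a directional derivative, below the
  contact order, would contradict the smallness of \<open>H2 - H1\<close> at two fixed points.
  Limits at the single points \<open>(x, 0)\<close> suffice, because they are taken in
  \<open>x\<close> and \<open>h\<close> together; this makes the extended quotient continuous. In
  the flow estimate the inverses are never subtracted: \<open>p1 (K2 w)\<close> is
  \<open>q (L1 (K2 w))\<close> near the slice, so the minus transforms are compared at one common
  point and only continuity of \<open>K2\<close> enters. The radii on which the inverse function
  theorem applies at \<open>(x, 0)\<close> may shrink to \<open>0\<close> as \<open>x\<close> goes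
  to infinity, so the inversion neighbourhood cannot be a strip of constant width. Since
  \<open>Ck_on\<close> speaks of derivatives in fixed directions only, every moving direction is
  expanded over \<open>Basis\<close>.\<close>

text \<open>For codomains of higher dimension the operator norm is in general not induced by an
  inner product. An instance takes classes rather than single types as arguments, so
  one-dimensionality is expressed by a class.\<close>

class real_line = euclidean_space +
  assumes is_singleton_Basis: "is_singleton Basis"

instance real :: real_line
  by standard (simp add: is_singleton_def)

text \<open>
  For values in a line the operator norm comes from an inner product. Hence the cotangent space and
  its dual are Euclidean spaces, and the library results for that class apply to them directly.
\<close>

instantiation blinfun :: (euclidean_space, real_line) euclidean_space
begin

text \<open>The Hilbert-Schmidt product; for functionals it is the Euclidean product of the
  representing vectors.\<close>

definition inner_blinfun :: "'a \<Rightarrow>\<^sub>L 'b \<Rightarrow> 'a \<Rightarrow>\<^sub>L 'b \<Rightarrow> real" where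
  "inner_blinfun f g = (\<Sum>b\<in>Basis. blinfun_apply f b \<bullet> blinfun_apply g b)"

definition Basis_blinfun :: "('a \<Rightarrow>\<^sub>L 'b) set" where
  "Basis_blinfun = (\<Union>e\<in>Basis. (\<lambda>b. blinfun_scaleR_left e o\<^sub>L blinfun_inner_left b) ` Basis)"

instance
proof
  obtain e :: 'b where e: "Basis = {e}"
    using is_singleton_Basis by (auto simp: is_singleton_def)
  have ee: "e \<bullet> e = 1"
    using e inner_same_Basis by blast
  have line: "y = (y \<bullet> e) *\<^sub>R e" for y :: 'b
    using euclidean_representation[of y] unfolding e by simp
  fix f g h :: "'a \<Rightarrow>\<^sub>L 'b" and r :: real
  show "inner f g = inner g f"
    by (simp add: inner_blinfun_def inner_commute)
  show "inner (f + g) h = inner f h + inner g h"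
    by (simp add: inner_blinfun_def plus_blinfun.rep_eq inner_add_left sum.distrib)
  show "inner (r *\<^sub>R f) g = r * inner f g"
    by (simp add: inner_blinfun_def scaleR_blinfun.rep_eq sum_distrib_left)
  show "0 \<le> inner f f"
    by (simp add: inner_blinfun_def sum_nonneg)
  have zero: "f = 0 \<longleftrightarrow> (\<forall>b\<in>Basis. blinfun_apply f b = 0)" for f :: "'a \<Rightarrow>\<^sub>L 'b"
    by (auto intro: blinfun_euclidean_eqI)
  show "inner f f = 0 \<longleftrightarrow> f = 0"
    by (simp add: inner_blinfun_def zero sum_nonneg_eq_0_iff)
  \<comment> \<open>The Riesz vector of \<open>f\<close>. Cauchy-Schwarz bounds the operator norm by
    \<open>norm v\<close>, and the argument \<open>v\<close> itself attains the bound.\<close>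
  define v where "v = (\<Sum>b\<in>Basis. (blinfun_apply f b \<bullet> e) *\<^sub>R b)"
  have fx: "blinfun_apply f x = (x \<bullet> v) *\<^sub>R e" for x
  proof -
    have "blinfun_apply f x \<bullet> e = blinfun_apply f (\<Sum>b\<in>Basis. (x \<bullet> b) *\<^sub>R b) \<bullet> e"
      by (simp add: euclidean_representation)
    also have "\<dots> = x \<bullet> v"
      by (simp add: v_def blinfun.sum_right blinfun.scaleR_right inner_sum_left inner_sum_right
          mult.commute)
    finally show ?thesis
      using line[of "blinfun_apply f x"] by simp
  qed
  have ne: "norm e = 1"
    using e by (metis insertI1 norm_Basis)
  have "norm f = norm v"
  proof (cases "v = 0")
    case True
    then have "f = 0"
      by (simp add: zero fx)
    with True show ?thesis by simp
  next
    case False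
    show ?thesis
    proof (rule norm_blinfun_eqI)
      show "norm v \<le> norm (blinfun_apply f v) / norm v"
        using False by (simp add: fx ne power2_norm_eq_inner[symmetric] power2_eq_square)
      show "norm (blinfun_apply f x) \<le> norm v * norm x" for x
        using Cauchy_Schwarz_ineq2[of x v] by (simp add: fx ne mult.commute)
    qed simp
  qed
  also have "norm v = sqrt (inner f f)"
    unfolding norm_eq_sqrt_inner[of v] inner_blinfun_def fx euclidean_inner[of v v]
    by (simp add: ee inner_commute)
  finally show "norm f = sqrt (inner f f)" .
  show "Basis \<noteq> ({} :: ('a \<Rightarrow>\<^sub>L 'b) set)" "finite (Basis :: ('a \<Rightarrow>\<^sub>L 'b) set)"
    by (auto simp: Basis_blinfun_def)
  have dual: "inner f (blinfun_scaleR_left e o\<^sub>L blinfun_inner_left b) = blinfun_apply f b \<bullet> e"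
    if "b \<in> Basis" for f :: "'a \<Rightarrow>\<^sub>L 'b" and b
  proof -
    have "inner f (blinfun_scaleR_left e o\<^sub>L blinfun_inner_left b)
        = (\<Sum>c\<in>Basis. if c = b then blinfun_apply f c \<bullet> e else 0)"
      unfolding inner_blinfun_def by (rule sum.cong) (auto simp: inner_Basis that)
    then show ?thesis
      using that by simp
  qed
  show "inner u w = (if u = w then 1 else 0)" if "u \<in> Basis" "w \<in> Basis" for u w :: "'a \<Rightarrow>\<^sub>L 'b"
  proof -
    obtain b c where b: "b \<in> Basis" "u = blinfun_scaleR_left e o\<^sub>L blinfun_inner_left b"
      and c: "c \<in> Basis" "w = blinfun_scaleR_left e o\<^sub>L blinfun_inner_left c"
      using \<open>u \<in> Basis\<close> \<open>w \<in> Basis\<close> by (auto simp: Basis_blinfun_def e)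
    have *: "inner u w = (if b = c then 1 else 0)"
      unfolding c(2) dual[OF c(1)] b(2) using b(1) c(1) by (simp add: inner_Basis ee)
    have "u = w \<longleftrightarrow> b = c"
    proof
      assume "u = w"
      moreover have "inner w w = 1"
        unfolding c(2) dual[OF c(1)] using c(1) by (simp add: ee)
      ultimately show "b = c"
        using * by (metis zero_neq_one)
    qed (simp add: b c)
    with * show ?thesis by simp
  qed
  show "(\<forall>u\<in>Basis. inner f u = 0) \<longleftrightarrow> f = 0"
  proof -
    have "(\<forall>u\<in>Basis. inner f u = 0) \<longleftrightarrow> (\<forall>b\<in>Basis. blinfun_apply f b \<bullet> e = 0)"
      using dual by (auto simp: Basis_blinfun_def e)
    also have "\<dots> \<longleftrightarrow> (\<forall>b\<in>Basis. blinfun_apply f b = 0)"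
      using line by (metis inner_zero_left scale_zero_left)
    finally show ?thesis
      using zero by simp
  qed
qed

end

section \<open>Calculus of smooth maps\<close>

lemma Ck_on_cong:
  assumes "open S" "\<And>x. x \<in> S \<Longrightarrow> f x = g x"
  shows "Ck_on k S f \<longleftrightarrow> Ck_on k S g"
  using assms(2)
proof (induction k arbitrary: f g)
  case 0
  then show ?case
    by (auto cong: continuous_on_cong)
next
  case (Suc k)
  have der: "(f has_derivative D) (at x) \<longleftrightarrow> (g has_derivative D) (at x)" if "x \<in> S" for x D
    using Suc.prems assms(1) that has_derivative_transform_within_open[of f D x UNIV S g]
      has_derivative_transform_within_open[of g D x UNIV S f] by auto
  have "Ck_on k S (\<lambda>x. frechet_derivative f (at x) v) \<longleftrightarrow>
      Ck_on k S (\<lambda>x. frechet_derivative g (at x) v)" for v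
    by (rule Suc.IH) (simp add: frechet_derivative_def der)
  then show ?case
    by (auto simp: differentiable_def der)
qed

lemma Ck_on_subset: "Ck_on k S f \<Longrightarrow> T \<subseteq> S \<Longrightarrow> Ck_on k T f"
  by (induction k arbitrary: f) (auto intro: continuous_on_subset)

text \<open>The recursion does not state that the classes decrease. Product and chain rule need this
  for the factor that stays undifferentiated.\<close>

lemma Ck_on_Suc_imp: "Ck_on (Suc k) S f \<Longrightarrow> Ck_on k S f"
proof (induction k arbitrary: f)
  case 0
  then show ?case
    by (auto intro!: continuous_at_imp_continuous_on differentiable_imp_continuous_within)
next
  case (Suc k)
  then show ?case
    by (metis Ck_on.simps(2))
qed

text \<open>Lets an explicit derivative replace the chosen \<open>frechet_derivative\<close>; the
  inductive closure rules below enter the recursion through it.\<close>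

lemma Ck_on_Suc_has_derivative:
  assumes "open S" "\<And>x. x \<in> S \<Longrightarrow> (f has_derivative f' x) (at x)"
    "\<And>v. Ck_on k S (\<lambda>x. f' x v)"
  shows "Ck_on (Suc k) S f"
proof -
  have "Ck_on k S (\<lambda>x. frechet_derivative f (at x) v) \<longleftrightarrow> Ck_on k S (\<lambda>x. f' x v)" for v
    by (rule Ck_on_cong[OF assms(1)]) (metis assms(2) frechet_derivative_at)
  then show ?thesis
    using assms(2,3) by (auto simp: differentiable_def)
qed

lemma Ck_on_SucD:
  assumes "Ck_on (Suc k) S f"
  shows "x \<in> S \<Longrightarrow> (f has_derivative frechet_derivative f (at x)) (at x)"
    and "Ck_on k S (\<lambda>x. frechet_derivative f (at x) v)"
  using assms by (auto simp: frechet_derivative_works)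

lemma Ck_on_const [simp]: "Ck_on k S (\<lambda>x. c)"
  by (induction k arbitrary: c) auto

lemma Ck_on_bounded_linear:
  assumes "bounded_linear T" "open S"
  shows "Ck_on k S T"
proof (cases k)
  case 0
  then show ?thesis
    using assms(1) by (simp add: linear_continuous_on)
next
  case (Suc j)
  show ?thesis
    unfolding Suc using assms
    by (intro Ck_on_Suc_has_derivative[where f' = "\<lambda>_. T"])
      (auto simp: bounded_linear_imp_has_derivative)
qed

lemma Ck_on_linear_compose:
  assumes "bounded_linear T" "open S" "Ck_on k S f"
  shows "Ck_on k S (\<lambda>x. T (f x))"
  using assms(3)
proof (induction k arbitrary: f)
  case 0
  then show ?case
    using assms(1) by (auto intro: bounded_linear.continuous_on)
next
  case (Suc k)
  show ?case
    using Ck_on_SucD[OF Suc.prems]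
    by (intro Ck_on_Suc_has_derivative[OF assms(2) bounded_linear.has_derivative[OF assms(1)]] Suc.IH)
      auto
qed

lemma Ck_on_add:
  assumes "open S" "Ck_on k S f" "Ck_on k S g"
  shows "Ck_on k S (\<lambda>x. f x + g x)"
  using assms(2,3)
proof (induction k arbitrary: f g)
  case 0
  then show ?case
    by (auto intro: continuous_on_add)
next
  case (Suc k)
  show ?case
    using Ck_on_SucD[OF Suc.prems(1)] Ck_on_SucD[OF Suc.prems(2)]
    by (intro Ck_on_Suc_has_derivative[OF assms(1) has_derivative_add] Suc.IH) auto
qed

lemma Ck_on_sum:
  assumes "open S" "\<And>i. i \<in> I \<Longrightarrow> Ck_on k S (f i)"
  shows "Ck_on k S (\<lambda>x. \<Sum>i\<in>I. f i x)"
  using assms(2) by (induction I rule: infinite_finite_induct) (auto intro: Ck_on_add assms(1))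

lemma Ck_on_minus:
  assumes "open S" "Ck_on k S f"
  shows "Ck_on k S (\<lambda>x. - f x)"
  by (rule Ck_on_linear_compose[OF _ assms]) (rule bounded_linear_minus[OF bounded_linear_ident])

lemma Ck_on_diff:
  assumes "open S" "Ck_on k S f" "Ck_on k S g"
  shows "Ck_on k S (\<lambda>x. f x - g x)"
  using Ck_on_add[OF assms(1,2) Ck_on_minus[OF assms(1,3)]] by simp

lemma Ck_on_bilinear:
  assumes "bounded_bilinear mul" "open S" "Ck_on k S f" "Ck_on k S g"
  shows "Ck_on k S (\<lambda>x. mul (f x) (g x))"
  using assms(3,4)
proof (induction k arbitrary: f g)
  case 0
  then show ?case
    using assms(1) by (auto intro: bounded_bilinear.continuous_on)
next
  case (Suc k)
  show ?case
    using Ck_on_SucD[OF Suc.prems(1)] Ck_on_SucD[OF Suc.prems(2)]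
      Suc.prems[THEN Ck_on_Suc_imp]
    by (intro Ck_on_Suc_has_derivative[OF assms(2), where f' = "\<lambda>x v.
          mul (f x) (frechet_derivative g (at x) v) + mul (frechet_derivative f (at x) v) (g x)"]
        bounded_bilinear.FDERIV[OF assms(1)] Ck_on_add[OF assms(2)] Suc.IH) auto
qed

lemma Ck_on_Pair:
  assumes "open S" "Ck_on k S f" "Ck_on k S g"
  shows "Ck_on k S (\<lambda>x. (f x, g x))"
proof -
  have "bounded_linear (\<lambda>x. (x, 0))" "bounded_linear (\<lambda>x. (0, x))"
    by (auto intro!: bounded_linear_intros)
  then have "Ck_on k S (\<lambda>x. (f x, 0) + (0, g x))"
    using assms by (intro Ck_on_add) (auto intro: Ck_on_linear_compose)
  then show ?thesis by simp
qed

lemma linear_eq_sum_Basis: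
  fixes T :: "'x::euclidean_space \<Rightarrow> 'y::real_vector"
  assumes "linear T"
  shows "T x = (\<Sum>b\<in>Basis. (x \<bullet> b) *\<^sub>R T b)"
  by (metis (no_types, lifting) assms euclidean_representation linear_cmul linear_sum sum.cong)

text \<open>The chain rule evaluates the derivative of \<open>g\<close> at a moving point in a
  moving direction, while \<open>Ck_on\<close> controls fixed directions only. Expanding the
  direction over \<open>Basis\<close> leaves products of coordinates of the derivative of
  \<open>f\<close> with derivatives of \<open>g\<close> in fixed directions, to which the induction
  hypothesis applies.\<close>

lemma Ck_on_compose:
  fixes f :: "'x::real_normed_vector \<Rightarrow> 'y::euclidean_space"
  assumes "open S" "open T" "f ` S \<subseteq> T" "Ck_on k S f" "Ck_on k T g"
  shows "Ck_on k S (\<lambda>x. g (f x))"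
  using assms(4,5)
proof (induction k arbitrary: g)
  case 0
  then show ?case
    using assms(3) by (auto intro: continuous_on_compose2)
next
  case (Suc k)
  note f = Ck_on_SucD[OF Suc.prems(1)] and g = Ck_on_SucD[OF Suc.prems(2)]
  have der: "((\<lambda>x. g (f x)) has_derivative
      (\<lambda>v. \<Sum>b\<in>Basis. (frechet_derivative f (at x) v \<bullet> b) *\<^sub>R frechet_derivative g (at (f x)) b)) (at x)"
    if "x \<in> S" for x
  proof -
    have gx: "(g has_derivative frechet_derivative g (at (f x))) (at (f x))"
      using g(1)[of "f x"] that assms(3) by blast
    have "frechet_derivative g (at (f x)) (frechet_derivative f (at x) v) = (\<Sum>b\<in>Basis.
        (frechet_derivative f (at x) v \<bullet> b) *\<^sub>R frechet_derivative g (at (f x)) b)" for v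
      using has_derivative_linear[OF gx] by (rule linear_eq_sum_Basis)
    then show ?thesis
      using has_derivative_compose[OF f(1)[OF that] gx] by presburger
  qed
  show ?case
  proof (rule Ck_on_Suc_has_derivative[OF assms(1) der])
    show "Ck_on k S (\<lambda>x. \<Sum>b\<in>Basis.
        (frechet_derivative f (at x) v \<bullet> b) *\<^sub>R frechet_derivative g (at (f x)) b)" for v
      using f(2) g(2) Suc.prems(1)[THEN Ck_on_Suc_imp]
      by (intro Ck_on_sum[OF assms(1)] Ck_on_bilinear[OF bounded_bilinear_scaleR assms(1)] Suc.IH
          Ck_on_linear_compose[OF bounded_linear_inner_left assms(1)]) auto
  qed
qed

lemma smooth_on_subset: "smooth_on S f \<Longrightarrow> T \<subseteq> S \<Longrightarrow> smooth_on T f"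
  unfolding smooth_on_def using Ck_on_subset by blast

lemma smooth_on_continuous: "smooth_on S f \<Longrightarrow> continuous_on S f"
  unfolding smooth_on_def using Ck_on.simps(1) by blast

lemma smooth_on_has_derivative:
  "smooth_on S f \<Longrightarrow> x \<in> S \<Longrightarrow> (f has_derivative frechet_derivative f (at x)) (at x)"
  unfolding smooth_on_def using Ck_on_SucD(1) by blast

lemma smooth_on_frechet_derivative:
  "smooth_on S f \<Longrightarrow> smooth_on S (\<lambda>x. frechet_derivative f (at x) v)"
  unfolding smooth_on_def using Ck_on_SucD(2) by blast

section \<open>The inverse function theorem for smooth maps\<close>

text \<open>Continuity of the derivative in each of the finitely many basis directions, collected in
  \<open>s\<close>, gives a bound uniform in all directions. The second estimate is the mean value
  inequality on a ball for \<open>f\<close> minus its linearisation at \<open>a\<close>.\<close>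

lemma strict_derivative:
  fixes f :: "'x::euclidean_space \<Rightarrow> 'y::real_normed_vector"
  assumes "open S" "smooth_on S f" "a \<in> S" "e > 0"
  obtains d where "d > 0" "ball a d \<subseteq> S"
    "\<And>x v. x \<in> ball a d \<Longrightarrow>
      norm (frechet_derivative f (at x) v - frechet_derivative f (at a) v) \<le> e * norm v"
    "\<And>x y. x \<in> ball a d \<Longrightarrow> y \<in> ball a d \<Longrightarrow>
      norm (f x - f y - frechet_derivative f (at a) (x - y)) \<le> e * norm (x - y)"
proof -
  define D where "D x = frechet_derivative f (at x)" for x
  have D: "(f has_derivative D x) (at x)" if "x \<in> S" for x
    using smooth_on_has_derivative[OF assms(2) that] by (simp add: D_def)
  define s where "s x = (\<Sum>b\<in>Basis. norm (D x b - D a b))" for x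
  have "continuous_on S s"
    unfolding s_def D_def
    by (intro continuous_intros smooth_on_continuous smooth_on_frechet_derivative assms(2))
  moreover have "s a = 0"
    by (simp add: s_def)
  ultimately have "(s \<longlongrightarrow> 0) (at a)"
    using assms(1,3) by (metis continuous_on_eq_continuous_at isCont_def)
  then have "\<forall>\<^sub>F x in at a. s x < e"
    using assms(4) order_tendstoD(2) by blast
  moreover have "\<forall>\<^sub>F x in at a. x \<in> S"
    using assms(1,3) by (simp add: eventually_at_in_open')
  ultimately have "\<forall>\<^sub>F x in at a. s x < e \<and> x \<in> S"
    by (rule eventually_conj)
  then obtain d where d: "d > 0" "\<And>x. x \<noteq> a \<Longrightarrow> dist x a < d \<Longrightarrow> s x < e \<and> x \<in> S"
    unfolding eventually_at by blast
  have near: "s x < e" "x \<in> S" if "x \<in> ball a d" for x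
    using d(2)[of x] that assms(3,4) \<open>s a = 0\<close> by (cases "x = a"; simp add: dist_commute)+
  have diff: "norm (D x v - D a v) \<le> e * norm v" if x: "x \<in> ball a d" for x v
  proof -
    have "linear (\<lambda>v. D x v - D a v)"
      using D[OF near(2)[OF x]] D[OF assms(3)] by (intro linear_compose_sub has_derivative_linear)
    then have "D x v - D a v = (\<Sum>b\<in>Basis. (v \<bullet> b) *\<^sub>R (D x b - D a b))"
      by (rule linear_eq_sum_Basis)
    also have "norm \<dots> \<le> (\<Sum>b\<in>Basis. norm v * norm (D x b - D a b))"
      by (intro sum_norm_le) (auto intro!: mult_right_mono Basis_le_norm)
    also have "\<dots> = norm v * s x"
      by (simp add: s_def sum_distrib_left)
    also have "\<dots> \<le> norm v * e"
      using near(1)[OF x] by (intro mult_left_mono) auto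
    finally show ?thesis
      by (simp add: mult.commute)
  qed
  show thesis
  proof (rule that[OF d(1)])
    show "ball a d \<subseteq> S"
      using near(2) by blast
    show "norm (frechet_derivative f (at x) v - frechet_derivative f (at a) v) \<le> e * norm v"
      if "x \<in> ball a d" for x v
      using diff[OF that] by (simp add: D_def)
    show "norm (f x - f y - frechet_derivative f (at a) (x - y)) \<le> e * norm (x - y)"
      if "x \<in> ball a d" "y \<in> ball a d" for x y
    proof -
      have "((\<lambda>x. f x - D a x) has_derivative (\<lambda>v. D x v - D a v)) (at x within ball a d)"
        if "x \<in> ball a d" for x
        using has_derivative_diff[OF D[OF near(2)[OF that]] bounded_linear_imp_has_derivative]
          has_derivative_bounded_linear[OF D[OF assms(3)]] by (blast intro: has_derivative_at_withinI)
      moreover have "onorm (\<lambda>v. D x v - D a v) \<le> e" if "x \<in> ball a d" for x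
        using diff[OF that] by (intro onorm_le) simp
      ultimately have bound: "norm ((f x - D a x) - (f y - D a y)) \<le> e * norm (x - y)"
        using that by (intro differentiable_bound[OF convex_ball]) auto
      have "D a (x - y) = D a x - D a y"
        using has_derivative_linear[OF D[OF assms(3)]] by (rule linear_diff)
      then have eq: "(f x - D a x) - (f y - D a y) = f x - f y - D a (x - y)"
        by simp
      show ?thesis
        using bound[unfolded eq] unfolding D_def .
    qed
  qed
qed

text \<open>An injective linear map in finite dimension is bounded below by some
  \<open>B > 0\<close>. Strict differentiability with tolerance \<open>B / 2\<close> leaves the
  constant \<open>B / 2\<close> both for the nearby derivatives and for the increments of
  \<open>f\<close>.\<close>

lemma locally_expanding:
  fixes f :: "'x::euclidean_space \<Rightarrow> 'y::euclidean_space"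
  assumes "open S" "smooth_on S f" "a \<in> S" "inj (frechet_derivative f (at a))"
  obtains c d where "c > 0" "d > 0" "ball a d \<subseteq> S"
    "\<And>x v. x \<in> ball a d \<Longrightarrow> c * norm v \<le> norm (frechet_derivative f (at x) v)"
    "\<And>x y. x \<in> ball a d \<Longrightarrow> y \<in> ball a d \<Longrightarrow> c * norm (x - y) \<le> norm (f x - f y)"
proof -
  let ?D = "\<lambda>x. frechet_derivative f (at x)"
  obtain B where B: "B > 0" "\<And>v. B * norm v \<le> norm (?D a v)"
    using linear_inj_bounded_below_pos[OF _ assms(4)]
      has_derivative_linear[OF smooth_on_has_derivative[OF assms(2,3)]] by blast
  have "B / 2 > 0"
    using B by simp
  from strict_derivative[OF assms(1-3) this]
  obtain d where d: "d > 0" "ball a d \<subseteq> S"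
    "\<And>x v. x \<in> ball a d \<Longrightarrow> norm (?D x v - ?D a v) \<le> B / 2 * norm v"
    "\<And>x y. x \<in> ball a d \<Longrightarrow> y \<in> ball a d \<Longrightarrow>
      norm (f x - f y - ?D a (x - y)) \<le> B / 2 * norm (x - y)"
    by metis
  show thesis
  proof (rule that[OF \<open>B / 2 > 0\<close> d(1,2)])
    show "B / 2 * norm v \<le> norm (?D x v)" if "x \<in> ball a d" for x v
      using d(3)[OF that, of v] B(2)[of v] norm_triangle_ineq3[of "?D x v" "?D a v"]
      by (simp add: field_simps)
    show "B / 2 * norm (x - y) \<le> norm (f x - f y)" if "x \<in> ball a d" "y \<in> ball a d" for x y
      using d(4)[OF that] B(2)[of "x - y"] norm_triangle_ineq3[of "f x - f y" "?D a (x - y)"]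
      by (simp add: field_simps)
  qed
qed

text \<open>The second factor need not be differentiable, because the first one vanishes.\<close>

lemma has_derivative_scaleR_vanishing:
  fixes \<phi> :: "'x::real_normed_vector \<Rightarrow> real" and g :: "'x \<Rightarrow> 'y::real_normed_vector"
  assumes \<phi>: "(\<phi> has_derivative \<phi>') (at a)" "\<phi> a = 0" and g: "isCont g a"
  shows "((\<lambda>x. \<phi> x *\<^sub>R g x) has_derivative (\<lambda>v. \<phi>' v *\<^sub>R g a)) (at a)"
  unfolding has_derivative_within
proof
  have lin: "bounded_linear \<phi>'"
    using \<phi>(1) by (rule has_derivative_bounded_linear)
  then show "bounded_linear (\<lambda>v. \<phi>' v *\<^sub>R g a)"
    by (rule bounded_linear_scaleR_const)
  obtain B where B: "\<And>v. norm (\<phi>' v) \<le> norm v * B"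
    using lin bounded_linear.bounded by blast
  have gl: "(g \<longlongrightarrow> g a) (at a)"
    using g by (simp add: isCont_def)
  have 1: "((\<lambda>y. ((1 / norm (y - a)) *\<^sub>R (\<phi> y - (\<phi> a + \<phi>' (y - a)))) *\<^sub>R g y) \<longlongrightarrow> 0 *\<^sub>R g a) (at a)"
    using \<phi>(1) gl unfolding has_derivative_within by (intro tendsto_scaleR) auto
  have 2: "((\<lambda>y. (\<phi>' (y - a) / norm (y - a)) *\<^sub>R (g y - g a)) \<longlongrightarrow> 0) (at a)"
  proof (rule tendsto_0_le[where K = B])
    show "((\<lambda>y. g y - g a) \<longlongrightarrow> 0) (at a)"
      using gl by (simp add: LIM_zero)
    have "\<bar>\<phi>' (y - a)\<bar> / norm (y - a) \<le> B" if "y \<noteq> a" for y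
      using B[of "y - a"] that by (simp add: pos_divide_le_eq mult.commute)
    then have "norm ((\<phi>' (y - a) / norm (y - a)) *\<^sub>R (g y - g a)) \<le> norm (g y - g a) * B"
      if "y \<noteq> a" for y
      using mult_left_mono[of "\<bar>\<phi>' (y - a)\<bar> / norm (y - a)" B "norm (g y - g a)"] that
      by (simp add: mult.commute)
    then show "\<forall>\<^sub>F y in at a. norm ((\<phi>' (y - a) / norm (y - a)) *\<^sub>R (g y - g a)) \<le> norm (g y - g a) * B"
      unfolding eventually_at by (intro exI[of _ 1]) simp
  qed
  show "((\<lambda>y. (1 / norm (y - a)) *\<^sub>R (\<phi> y *\<^sub>R g y - (\<phi> a *\<^sub>R g a + \<phi>' (y - a) *\<^sub>R g a))) \<longlongrightarrow> 0) (at a)"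
    using tendsto_add[OF 1 2] \<phi>(2) by (simp add: algebra_simps)
qed

section \<open>Smoothness of the inverse map\<close>

text \<open>The derivative of \<open>g\<close> at \<open>y\<close> is the inverse \<open>K y\<close>
  of the derivative of \<open>f\<close> at \<open>g y\<close>. The map
  \<open>y \<mapsto> K y v\<close> is differentiated by hand, and its derivative is a polynomial in
  coordinates of \<open>K\<close> and second derivatives of \<open>f\<close> along \<open>g\<close>.
  Hence \<open>g\<close> and all maps \<open>y \<mapsto> K y v\<close> gain regularity in one
  simultaneous induction.\<close>

lemma smooth_on_inverse:
  fixes f g :: "'x::euclidean_space \<Rightarrow> 'x"
  assumes S: "open S" and T: "open T" and f: "smooth_on S f" and gT: "g ` T \<subseteq> S"
    and fg: "\<And>y. y \<in> T \<Longrightarrow> f (g y) = y" and cont: "continuous_on T g"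
    and inj: "\<And>x. x \<in> S \<Longrightarrow> inj (frechet_derivative f (at x))"
  shows "smooth_on T g"
proof -
  let ?D = "\<lambda>x. frechet_derivative f (at x)"
  define E where "E c x = ?D x c" for c x
  define E2 where "E2 c d x = frechet_derivative (E c) (at x) d" for c d x
  have gS: "g y \<in> S" if "y \<in> T" for y
    using gT that by blast
  have D: "(f has_derivative ?D x) (at x)" "linear (?D x)" if "x \<in> S" for x
    using smooth_on_has_derivative[OF f that] has_derivative_linear by auto
  have E: "smooth_on S (E c)" for c
    unfolding E_def using f by (rule smooth_on_frechet_derivative)
  have E2: "smooth_on S (E2 c d)" for c d
    unfolding E2_def using E by (rule smooth_on_frechet_derivative)
  have "\<forall>y. \<exists>K. y \<in> T \<longrightarrow> linear K \<and> (\<forall>v. K (?D (g y) v) = v) \<and> (\<forall>v. ?D (g y) (K v) = v)"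
    using linear_injective_isomorphism[OF D(2) inj] gS by metis
  then obtain K where K: "\<And>y. y \<in> T \<Longrightarrow> linear (K y)"
    "\<And>y v. y \<in> T \<Longrightarrow> K y (?D (g y) v) = v" "\<And>y v. y \<in> T \<Longrightarrow> ?D (g y) (K y v) = v"
    by metis
  have g': "(g has_derivative K y) (at y)" if "y \<in> T" for y
  proof (rule has_derivative_inverse_basic[OF D(1)[OF gS[OF that]] _ _ _ T that fg])
    show "bounded_linear (K y)"
      using K(1)[OF that] by (simp add: linear_conv_bounded_linear)
    show "continuous (at y) g"
      using cont T that by (simp add: continuous_on_eq_continuous_at)
  qed (use K(2)[OF that] in auto)
  \<comment> \<open>The derivative of \<open>f\<close> at \<open>g y\<close> sends
    \<open>K y v - K y0 v\<close> to \<open>v\<close> minus its value at \<open>K y0 v\<close>,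
    which tends to \<open>0\<close>. The lower bound \<open>c\<close>, uniform near
    \<open>g y0\<close>, carries this back to \<open>K y v - K y0 v\<close>.\<close>
  have K_cont: "isCont (\<lambda>y. K y v) y0" if y0: "y0 \<in> T" for y0 v
  proof -
    obtain c d where cd: "c > 0" "d > 0" "ball (g y0) d \<subseteq> S"
      "\<And>x v. x \<in> ball (g y0) d \<Longrightarrow> c * norm v \<le> norm (?D x v)"
      using locally_expanding[OF S f gS[OF y0] inj[OF gS[OF y0]]] by metis
    have gcont: "isCont g y0"
      using cont T y0 by (simp add: continuous_on_eq_continuous_at)
    have "isCont (\<lambda>y. E (K y0 v) (g y)) y0"
      using smooth_on_continuous[OF E] gS[OF y0] S
      by (intro isCont_o2[OF gcont]) (simp add: continuous_on_eq_continuous_at)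
    then have lim: "((\<lambda>y. E (K y0 v) (g y) - E (K y0 v) (g y0)) \<longlongrightarrow> 0) (at y0)"
      by (simp add: isCont_def LIM_zero)
    have "\<forall>\<^sub>F y in at y0. g y \<in> ball (g y0) d"
      using gcont cd(2) unfolding isCont_def by (intro topological_tendstoD) auto
    moreover have "\<forall>\<^sub>F y in at y0. y \<in> T"
      using T y0 by (simp add: eventually_at_in_open')
    ultimately have "\<forall>\<^sub>F y in at y0.
        norm (K y v - K y0 v) \<le> norm (E (K y0 v) (g y) - E (K y0 v) (g y0)) * (1 / c)"
    proof eventually_elim
      case (elim y)
      have "?D (g y) (K y v - K y0 v) = - (E (K y0 v) (g y) - E (K y0 v) (g y0))"
        using elim y0 by (simp add: linear_diff[OF D(2)[OF gS]] K(3) E_def)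
      then have "c * norm (K y v - K y0 v) \<le> norm (E (K y0 v) (g y) - E (K y0 v) (g y0))"
        using cd(4)[OF elim(1), of "K y v - K y0 v"] by (metis norm_minus_cancel)
      then show ?case
        using cd(1) by (simp add: field_simps)
    qed
    then have "((\<lambda>y. K y v - K y0 v) \<longlongrightarrow> 0) (at y0)"
      by (rule tendsto_0_le[OF lim])
    then show ?thesis
      by (simp add: isCont_def LIM_zero_iff)
  qed
  have K': "((\<lambda>y. K y v) has_derivative (\<lambda>u. - (\<Sum>b\<in>Basis. \<Sum>c\<in>Basis. \<Sum>d\<in>Basis.
      ((K y0 v \<bullet> c) * (K y0 u \<bullet> d) * (E2 c d (g y0) \<bullet> b)) *\<^sub>R K y0 b))) (at y0)"
    if y0: "y0 \<in> T" for v y0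
  proof -
    define w where "w = K y0 v"
    \<comment> \<open>The coordinates of the residual left when the fixed vector \<open>w\<close> is
      tried as a solution at \<open>y\<close>. Subtracting \<open>K y\<close> of the residual
      corrects \<open>w\<close> to \<open>K y v\<close>. As the residual vanishes at
      \<open>y0\<close>, differentiating the correction there needs only continuity of
      \<open>K\<close>.\<close>
    define \<phi> where "\<phi> b y = ((\<Sum>c\<in>Basis. (w \<bullet> c) *\<^sub>R E c (g y)) - v) \<bullet> b" for b y
    have Dw: "?D x w = (\<Sum>c\<in>Basis. (w \<bullet> c) *\<^sub>R E c x)" if "x \<in> S" for x
      unfolding E_def using D(2)[OF that] by (rule linear_eq_sum_Basis)
    have \<phi>0: "\<phi> b y0 = 0" for b
      using Dw[OF gS[OF y0]] K(3)[OF y0] by (simp add: \<phi>_def w_def)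
    have Kv: "K y v = w - (\<Sum>b\<in>Basis. \<phi> b y *\<^sub>R K y b)" if "y \<in> T" for y
    proof -
      have "(\<Sum>b\<in>Basis. \<phi> b y *\<^sub>R K y b) = K y (?D (g y) w - v)"
        unfolding \<phi>_def Dw[OF gS[OF that], symmetric]
        by (rule linear_eq_sum_Basis[OF K(1)[OF that], symmetric])
      also have "\<dots> = w - K y v"
        by (simp add: linear_diff[OF K(1)[OF that]] K(2)[OF that])
      finally show ?thesis by simp
    qed
    have Ec: "((\<lambda>y. E c (g y)) has_derivative (\<lambda>u. \<Sum>d\<in>Basis. (K y0 u \<bullet> d) *\<^sub>R E2 c d (g y0))) (at y0)" for c
    proof -
      have Ec: "(E c has_derivative frechet_derivative (E c) (at (g y0))) (at (g y0))"
        using smooth_on_has_derivative[OF E gS[OF y0]] .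
      have "frechet_derivative (E c) (at (g y0)) (K y0 u) = (\<Sum>d\<in>Basis. (K y0 u \<bullet> d) *\<^sub>R E2 c d (g y0))" for u
        unfolding E2_def using has_derivative_linear[OF Ec] by (rule linear_eq_sum_Basis)
      then show ?thesis
        using has_derivative_compose[OF g'[OF y0] Ec] by presburger
    qed
    have \<phi>': "(\<phi> b has_derivative (\<lambda>u. (\<Sum>c\<in>Basis. (w \<bullet> c) *\<^sub>R (\<Sum>d\<in>Basis. (K y0 u \<bullet> d) *\<^sub>R E2 c d (g y0))) \<bullet> b)) (at y0)" for b
      unfolding \<phi>_def by (auto intro!: derivative_eq_intros Ec)
    have "((\<lambda>y. w - (\<Sum>b\<in>Basis. \<phi> b y *\<^sub>R K y b)) has_derivative
       (\<lambda>u. 0 - (\<Sum>b\<in>Basis. ((\<Sum>c\<in>Basis. (w \<bullet> c) *\<^sub>R (\<Sum>d\<in>Basis. (K y0 u \<bullet> d) *\<^sub>R E2 c d (g y0))) \<bullet> b) *\<^sub>R K y0 b))) (at y0)"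
      by (intro has_derivative_diff has_derivative_const has_derivative_sum
          has_derivative_scaleR_vanishing \<phi>' \<phi>0 K_cont[OF y0])
    moreover have "0 - (\<Sum>b\<in>Basis. ((\<Sum>c\<in>Basis. (w \<bullet> c) *\<^sub>R (\<Sum>d\<in>Basis. (K y0 u \<bullet> d) *\<^sub>R E2 c d (g y0))) \<bullet> b) *\<^sub>R K y0 b)
        = - (\<Sum>b\<in>Basis. \<Sum>c\<in>Basis. \<Sum>d\<in>Basis.
          ((K y0 v \<bullet> c) * (K y0 u \<bullet> d) * (E2 c d (g y0) \<bullet> b)) *\<^sub>R K y0 b)" for u
      by (simp add: w_def inner_sum_left scaleR_sum_left sum_distrib_left mult.assoc)
    ultimately have "((\<lambda>y. w - (\<Sum>b\<in>Basis. \<phi> b y *\<^sub>R K y b)) has_derivative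
        (\<lambda>u. - (\<Sum>b\<in>Basis. \<Sum>c\<in>Basis. \<Sum>d\<in>Basis.
          ((K y0 v \<bullet> c) * (K y0 u \<bullet> d) * (E2 c d (g y0) \<bullet> b)) *\<^sub>R K y0 b))) (at y0)"
      by simp
    then show ?thesis
      by (rule has_derivative_transform_within_open[OF _ T y0]) (simp add: Kv)
  qed
  have "Ck_on k T g \<and> (\<forall>v. Ck_on k T (\<lambda>y. K y v))" for k
  proof (induction k)
    case 0
    have "continuous_on T (\<lambda>y. K y v)" for v
      using K_cont by (intro continuous_at_imp_continuous_on) blast
    with cont show ?case
      by simp
  next
    case (Suc k)
    have E2g: "Ck_on k T (\<lambda>y. E2 c d (g y))" for c d
      using Suc.IH E2 unfolding smooth_on_def
      by (intro Ck_on_compose[OF T S gT, of k "E2 c d"]) auto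
    have "Ck_on k T (\<lambda>y. - (\<Sum>b\<in>Basis. \<Sum>c\<in>Basis. \<Sum>d\<in>Basis.
      ((K y v \<bullet> c) * (K y u \<bullet> d) * (E2 c d (g y) \<bullet> b)) *\<^sub>R K y b))" for u v
      using Suc.IH E2g
      by (intro Ck_on_minus Ck_on_sum Ck_on_bilinear[OF bounded_bilinear_scaleR]
          Ck_on_bilinear[OF bounded_bilinear_mult] Ck_on_linear_compose[OF bounded_linear_inner_left] T)
        auto
    then have "Ck_on (Suc k) T (\<lambda>y. K y v)" for v
      by (intro Ck_on_Suc_has_derivative[OF T K'])
    moreover have "Ck_on (Suc k) T g"
      using Suc.IH by (intro Ck_on_Suc_has_derivative[OF T g']) auto
    ultimately show ?case
      by blast
  qed
  then show ?thesis
    by (simp add: smooth_on_def)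
qed

text \<open>Domain and codomain have equal dimension, so invariance of domain yields the open image
  and the continuous inverse that \<open>smooth_on_inverse\<close> presupposes.\<close>

lemma diffeo_between_image:
  fixes f :: "'x::euclidean_space \<Rightarrow> 'x"
  assumes "open S" "smooth_on S f" "inj_on f S"
    and "\<And>x. x \<in> S \<Longrightarrow> inj (frechet_derivative f (at x))"
  shows "diffeo_between S (f ` S) f"
proof -
  have cont: "continuous_on S f"
    using assms(2) by (rule smooth_on_continuous)
  have "open (f ` S)"
    using invariance_of_domain[OF cont assms(1,3)] .
  have "smooth_on (f ` S) (inv_into S f)"
  proof (rule smooth_on_inverse[OF assms(1) \<open>open (f ` S)\<close> assms(2) _ _ _ assms(4)])
    show "continuous_on (f ` S) (inv_into S f)"
      using assms(1,3) cont by (intro continuous_on_inverse_open) (simp_all add: inv_into_f_f)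
  qed (simp_all add: f_inv_into_f inv_into_into image_subset_iff)
  then show ?thesis
    using assms \<open>open (f ` S)\<close> by (simp add: diffeo_between_def inj_on_imp_bij_betw)
qed

section \<open>Inversion near the slice \<open>h = 0\<close>\<close>

text \<open>A kernel vector has the form \<open>(u, 0)\<close>. Differentiating the identity
  \<open>k (l (y, 0)) = y\<close> shows that \<open>l'\<close> has a left inverse on such vectors,
  so \<open>u = 0\<close>.\<close>

lemma inj_derivative_suspension:
  fixes l :: "'x::euclidean_space \<times> real \<Rightarrow> 'x"
  assumes l: "(l has_derivative l') (at (x, 0))"
    and diffeo: "diffeo_between UNIV UNIV (\<lambda>x. l (x, 0))"
  shows "inj (\<lambda>v. (l' v, snd v))"
proof -
  define k where "k = inv_into UNIV (\<lambda>x. l (x, 0))"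
  obtain k' where k': "(k has_derivative k') (at (l (x, 0)))"
    using smooth_on_has_derivative[of UNIV k "l (x, 0)"] diffeo
    unfolding diffeo_between_def k_def by auto
  have "k (l (x, 0)) = x" for x
    using diffeo inv_into_f_f[of "\<lambda>x. l (x, 0)" UNIV x]
    by (simp add: diffeo_between_def bij_betw_def k_def)
  moreover have "((\<lambda>y. (y, 0 :: real)) has_derivative (\<lambda>u. (u, 0))) (at x)"
    by (rule has_derivative_Pair[OF has_derivative_ident has_derivative_const])
  then have "((\<lambda>y. l (y, 0)) has_derivative (\<lambda>u. l' (u, 0))) (at x)"
    using has_derivative_compose[of "\<lambda>y. (y, 0)" "\<lambda>u. (u, 0)" x UNIV l l'] l by simp
  then have "((\<lambda>y. k (l (y, 0))) has_derivative (\<lambda>u. k' (l' (u, 0)))) (at x)"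
    using has_derivative_compose[of "\<lambda>y. l (y, 0)" _ x UNIV k k'] k' by simp
  ultimately have "(\<lambda>u. k' (l' (u, 0))) = (\<lambda>u. u)"
    using has_derivative_unique[OF _ has_derivative_ident] by simp
  then have "u = 0" if "l' (u, 0) = 0" for u
    using that linear_0[OF has_derivative_linear[OF k']] by metis
  moreover have "linear (\<lambda>v. (l' v, snd v))"
    by (rule has_derivative_linear[OF has_derivative_Pair[OF l
          bounded_linear_imp_has_derivative[OF bounded_linear_snd]]])
  ultimately show ?thesis
    by (auto simp: linear_injective_0 zero_prod_def)
qed

text \<open>
  Local injectivity near each \<open>(x, 0)\<close> is made global as follows: two points with the same image
  have the same \<open>y\<close>, the preimage of their common first component under \<open>l (-, 0)\<close>. So it suffices
  to keep the points that lie in a ball around their \<open>(y, 0)\<close> on which the map is injective.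
\<close>

proposition suspension_diffeo:
  fixes l :: "'x::euclidean_space \<times> real \<Rightarrow> 'x"
  assumes W: "open W" "UNIV \<times> {0} \<subseteq> W" and l: "smooth_on W l"
    and diffeo: "diffeo_between UNIV UNIV (\<lambda>x. l (x, 0))"
  defines "L \<equiv> \<lambda>w. (l w, snd w)"
  shows "\<exists>U. UNIV \<times> {0} \<subseteq> U \<and> U \<subseteq> W \<and> UNIV \<times> {0} \<subseteq> L ` U \<and> diffeo_between U (L ` U) L"
proof -
  define k where "k = inv_into UNIV (\<lambda>x. l (x, 0))"
  have bij: "bij (\<lambda>x. l (x, 0))" and contk: "continuous_on UNIV k"
    using diffeo by (auto simp: diffeo_between_def k_def smooth_on_continuous)
  then have k: "k (l (x, 0)) = x" for x
    using inv_into_f_f[of "\<lambda>x. l (x, 0)" UNIV x] by (simp add: bij_def k_def)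
  have L: "smooth_on W L"
    using l W(1) Ck_on_bounded_linear[OF bounded_linear_snd W(1)]
    by (simp add: L_def smooth_on_def Ck_on_Pair)
  define G where "G w = k (l w)" for w
  have contG: "continuous_on W G"
    unfolding G_def using continuous_on_compose2[OF contk smooth_on_continuous[OF l]] by simp
  have G0: "G (x, 0) = x" for x
    by (simp add: G_def k)
  define good where
    "good B \<longleftrightarrow> B \<subseteq> W \<and> inj_on L B \<and> (\<forall>w\<in>B. inj (frechet_derivative L (at w)))" for B
  have good_mono: "good A" if "good B" "A \<subseteq> B" for A B
    using that unfolding good_def by (meson inj_on_subset order_trans subsetD)
  have good: "\<exists>\<rho>>0. good (ball (x, 0) \<rho>)" for x
  proof -
    have x: "(x, 0) \<in> W"
      using W(2) by auto
    have "(L has_derivative (\<lambda>v. (frechet_derivative l (at (x, 0)) v, snd v))) (at (x, 0))"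
      unfolding L_def
      by (intro has_derivative_Pair smooth_on_has_derivative[OF l x]
          bounded_linear_imp_has_derivative bounded_linear_snd)
    then have "frechet_derivative L (at (x, 0)) = (\<lambda>v. (frechet_derivative l (at (x, 0)) v, snd v))"
      by (rule frechet_derivative_at[symmetric])
    then have "inj (frechet_derivative L (at (x, 0)))"
      using inj_derivative_suspension[OF smooth_on_has_derivative[OF l x] diffeo] by simp
    from locally_expanding[OF W(1) L x this] obtain c d where
      cd: "c > 0" "d > 0" "ball (x, 0) d \<subseteq> W"
        "\<And>w v. w \<in> ball (x, 0) d \<Longrightarrow> c * norm v \<le> norm (frechet_derivative L (at w) v)"
        "\<And>w w'. w \<in> ball (x, 0) d \<Longrightarrow> w' \<in> ball (x, 0) d \<Longrightarrow> c * norm (w - w') \<le> norm (L w - L w')"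
      by metis
    have "inj_on L (ball (x, 0) d)"
    proof (rule inj_onI)
      fix w w' assume "w \<in> ball (x, 0) d" "w' \<in> ball (x, 0) d" "L w = L w'"
      then have "c * norm (w - w') \<le> 0"
        using cd(5)[of w w'] by simp
      then show "w = w'"
        using cd(1) by (simp add: mult_le_0_iff)
    qed
    moreover have "inj (frechet_derivative L (at w))" if "w \<in> ball (x, 0) d" for w
    proof -
      have "w \<in> W"
        using cd(3) that by blast
      then have "linear (frechet_derivative L (at w))"
        using smooth_on_has_derivative[OF L] has_derivative_linear by blast
      moreover have "v = 0" if "frechet_derivative L (at w) v = 0" for v
        using cd(4)[OF \<open>w \<in> ball (x, 0) d\<close>, of v] cd(1) that by (simp add: mult_le_0_iff)
      ultimately show ?thesis
        by (simp add: linear_injective_0)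
    qed
    ultimately show ?thesis
      using cd(2,3) by (auto simp: good_def)
  qed
  \<comment> \<open>The ball is centred at \<open>(G w, 0)\<close> and not at \<open>w\<close>,
    because \<open>G\<close> factors through \<open>l\<close>: points with the same image share the
    centre.\<close>
  define U where "U = {w \<in> W. \<exists>\<rho>. dist w (G w, 0) < \<rho> \<and> good (ball (G w, 0) \<rho>)}"
  have UW: "U \<subseteq> W"
    by (auto simp: U_def)
  have U0: "UNIV \<times> {0} \<subseteq> U"
    using W(2) good by (auto simp: U_def G0)
  have "inj_on L U"
  proof (rule inj_onI)
    fix w w' assume w: "w \<in> U" "w' \<in> U" "L w = L w'"
    then have G: "G w = G w'"
      by (simp add: L_def G_def)
    obtain \<rho> \<rho>' where \<rho>: "dist w (G w, 0) < \<rho>" "good (ball (G w, 0) \<rho>)"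
      "dist w' (G w, 0) < \<rho>'" "good (ball (G w, 0) \<rho>')"
      using w(1,2) unfolding U_def mem_Collect_eq G[symmetric] by blast
    \<comment> \<open>The radii found for the two points may differ, but the balls are concentric,
      so the larger one contains both points and is still good.\<close>
    then have "good (ball (G w, 0) (max \<rho> \<rho>'))"
      by (simp add: max_def)
    with \<rho> w(3) show "w = w'"
      unfolding good_def inj_on_def by (metis dist_commute less_max_iff_disj mem_ball)
  qed
  moreover have "inj (frechet_derivative L (at w))" if "w \<in> U" for w
    using that by (auto simp: U_def good_def dist_commute)
  moreover have "open U"
    unfolding open_contains_ball
  proof
    fix w assume w: "w \<in> U"
    then obtain \<rho> where \<rho>: "dist w (G w, 0) < \<rho>" "good (ball (G w, 0) \<rho>)"
      by (auto simp: U_def)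
    \<comment> \<open>The slack is shared in three: one part for moving \<open>w\<close>, one for
      moving the centre, and one for shrinking the radius to \<open>\<rho> - \<eta>\<close>, which
      keeps the ball around the new centre inside the old good ball.\<close>
    define \<eta> where "\<eta> = (\<rho> - dist w (G w, 0)) / 3"
    have \<eta>: "\<eta> > 0"
      using \<rho> by (simp add: \<eta>_def)
    have "isCont G w"
      using contG W(1) w UW by (auto simp: continuous_on_eq_continuous_at)
    then obtain d1 where d1: "d1 > 0" "\<And>w'. dist w' w < d1 \<Longrightarrow> dist (G w') (G w) < \<eta>"
      using \<eta> unfolding continuous_at_eps_delta by metis
    obtain d2 where d2: "d2 > 0" "ball w d2 \<subseteq> W"
      using W(1) w UW unfolding open_contains_ball by blast
    have "ball w (min \<eta> (min d1 d2)) \<subseteq> U"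
    proof
      fix w' assume "w' \<in> ball w (min \<eta> (min d1 d2))"
      then have w': "dist w' w < \<eta>" "dist (G w') (G w) < \<eta>" "w' \<in> W"
        using d1(2)[of w'] d2 by (auto simp: dist_commute)
      have Gd: "dist (G w', 0) (G w, 0 :: real) < \<eta>"
        using w'(2) by (simp add: dist_Pair_Pair)
      have "dist w' (G w', 0) \<le> dist w' w + dist w (G w, 0) + dist (G w', 0) (G w, 0 :: real)"
        using dist_triangle[of w' "(G w', 0)" w] dist_triangle[of w "(G w', 0)" "(G w, 0)"]
        by (simp add: dist_commute)
      then have "dist w' (G w', 0) < \<rho> - \<eta>"
        using w'(1) Gd by (simp add: \<eta>_def field_simps)
      moreover have "ball (G w', 0 :: real) (\<rho> - \<eta>) \<subseteq> ball (G w, 0) \<rho>"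
        using Gd by (simp add: ball_subset_ball_iff)
      ultimately show "w' \<in> U"
        using w'(3) good_mono[OF \<rho>(2)] by (auto simp: U_def)
    qed
    with \<eta> d1(1) d2(1) show "\<exists>e>0. ball w e \<subseteq> U"
      by (intro exI[of _ "min \<eta> (min d1 d2)"]) auto
  qed
  ultimately have "diffeo_between U (L ` U) L"
    using diffeo_between_image[OF _ smooth_on_subset[OF L UW]] by blast
  moreover have "UNIV \<times> {0} \<subseteq> L ` U"
  proof
    fix w :: "'x \<times> real" assume "w \<in> UNIV \<times> {0}"
    then have "w = L (k (fst w), 0)"
      using bij surj_f_inv_f[of "\<lambda>x. l (x, 0)" "fst w"]
      by (cases w) (simp add: L_def k_def bij_def)
    then show "w \<in> L ` U"
      using U0 by (metis Sigma_mono UNIV_I imageI mem_Times_iff fst_conv snd_conv singletonI subsetD)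
  qed
  ultimately show ?thesis
    using U0 UW by blast
qed

section \<open>Contact order as a limit\<close>

text \<open>The limit excludes \<open>h = 0\<close>, where the quotient takes the junk value \<open>0\<close>.\<close>

definition vanishing_order :: "nat \<Rightarrow> ('x::real_normed_vector \<times> real \<Rightarrow> 'y::real_normed_vector) \<Rightarrow> bool" where
  "vanishing_order n f \<longleftrightarrow>
     (\<forall>x. \<exists>l. ((\<lambda>w. f w /\<^sub>R snd w ^ n) \<longlongrightarrow> l) (at (x, 0) within {w. snd w \<noteq> 0}))"

lemma at_within_snd_nonzero_neq_bot:
  "at (x :: 'x::real_normed_vector, 0 :: real) within {w. snd w \<noteq> 0} \<noteq> bot"
proof -
  have "(x, 0 :: real) islimpt {w. snd w \<noteq> 0}"
    unfolding islimpt_approachable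
  proof (intro allI impI)
    fix e :: real assume "e > 0"
    then show "\<exists>w\<in>{w. snd w \<noteq> 0}. w \<noteq> (x, 0 :: real) \<and> dist w (x, 0) < e"
      by (intro bexI[of _ "(x, e / 2)"]) (auto simp: dist_Pair_Pair)
  qed
  then show ?thesis
    by (simp add: trivial_limit_within)
qed

lemma eventually_at_within_nbhd:
  assumes "open W" "UNIV \<times> {0} \<subseteq> W"
  shows "\<forall>\<^sub>F w in at (x, 0) within S. w \<in> W"
proof -
  have "(x, 0) \<in> W"
    using assms(2) by auto
  then have "\<forall>\<^sub>F w in nhds (x, 0). w \<in> W"
    using assms(1) eventually_nhds by blast
  then show ?thesis
    by (simp add: eventually_at_filter eventually_mono)
qed

lemma tendsto_at_within_snd_nonzeroD:
  assumes "(f \<longlongrightarrow> l) (at (x, 0 :: real) within {w. snd w \<noteq> 0})" "e > 0"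
  obtains d where "d > 0" "\<And>w. snd w \<noteq> 0 \<Longrightarrow> dist w (x, 0) < d \<Longrightarrow> dist (f w) l < e"
proof -
  obtain d where d: "d > 0"
    "\<forall>w\<in>{w. snd w \<noteq> 0}. 0 < dist w (x, 0) \<and> dist w (x, 0) < d \<longrightarrow> dist (f w) l < e"
    using assms unfolding Lim_within by blast
  show thesis
  proof (rule that[OF d(1)])
    show "dist (f w) l < e" if "snd w \<noteq> 0" "dist w (x, 0) < d" for w
    proof -
      have "w \<noteq> (x, 0)"
        using that(1) by auto
      then show ?thesis
        using d(2)[rule_format, of w] that by simp
    qed
  qed
qed

lemma vanishing_order_cong:
  assumes "open W" "UNIV \<times> {0} \<subseteq> W" "\<And>w. w \<in> W \<Longrightarrow> f w = g w" "vanishing_order n f"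
  shows "vanishing_order n g"
  unfolding vanishing_order_def
proof
  fix x
  obtain l where l: "((\<lambda>w. f w /\<^sub>R snd w ^ n) \<longlongrightarrow> l) (at (x, 0) within {w. snd w \<noteq> 0})"
    using assms(4) unfolding vanishing_order_def by blast
  have "((\<lambda>w. g w /\<^sub>R snd w ^ n) \<longlongrightarrow> l) (at (x, 0) within {w. snd w \<noteq> 0})"
    by (rule Lim_transform_eventually[OF l])
      (rule eventually_mono[OF eventually_at_within_nbhd[OF assms(1,2)]], simp add: assms(3))
  then show "\<exists>l. ((\<lambda>w. g w /\<^sub>R snd w ^ n) \<longlongrightarrow> l) (at (x, 0) within {w. snd w \<noteq> 0})"
    by blast
qed

lemma vanishing_order_linear:
  assumes "bounded_linear T" "vanishing_order n f"
  shows "vanishing_order n (\<lambda>w. T (f w))"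
  unfolding vanishing_order_def
proof
  fix x
  obtain l where "((\<lambda>w. f w /\<^sub>R snd w ^ n) \<longlongrightarrow> l) (at (x, 0) within {w. snd w \<noteq> 0})"
    using assms(2) unfolding vanishing_order_def by blast
  from bounded_linear.tendsto[OF assms(1) this]
  show "\<exists>l. ((\<lambda>w. T (f w) /\<^sub>R snd w ^ n) \<longlongrightarrow> l) (at (x, 0) within {w. snd w \<noteq> 0})"
    by (auto simp: linear_cmul[OF bounded_linear.linear[OF assms(1)]])
qed

lemma vanishing_order_0 [simp]: "vanishing_order n (\<lambda>w. 0)"
  unfolding vanishing_order_def by (auto intro: exI[of _ 0])

lemma vanishing_order_add:
  assumes "vanishing_order n f" "vanishing_order n g"
  shows "vanishing_order n (\<lambda>w. f w + g w)"
  unfolding vanishing_order_def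
proof
  fix x
  obtain l m where "((\<lambda>w. f w /\<^sub>R snd w ^ n) \<longlongrightarrow> l) (at (x, 0) within {w. snd w \<noteq> 0})"
    "((\<lambda>w. g w /\<^sub>R snd w ^ n) \<longlongrightarrow> m) (at (x, 0) within {w. snd w \<noteq> 0})"
    using assms unfolding vanishing_order_def by blast
  from tendsto_add[OF this]
  show "\<exists>l. ((\<lambda>w. (f w + g w) /\<^sub>R snd w ^ n) \<longlongrightarrow> l) (at (x, 0) within {w. snd w \<noteq> 0})"
    by (auto simp: scaleR_add_right)
qed

lemma vanishing_order_sum:
  assumes "\<And>i. i \<in> I \<Longrightarrow> vanishing_order n (f i)"
  shows "vanishing_order n (\<lambda>w. \<Sum>i\<in>I. f i w)"
  using assms by (induction I rule: infinite_finite_induct) (auto intro: vanishing_order_add)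

lemma vanishing_order_diff:
  assumes "vanishing_order n f" "vanishing_order n g"
  shows "vanishing_order n (\<lambda>w. f w - g w)"
  using vanishing_order_add[OF assms(1) vanishing_order_linear[OF _ assms(2), of uminus]]
  by (simp add: bounded_linear_minus[OF bounded_linear_ident])

lemma contact_order_imp_vanishing_order:
  assumes "contact_order r W1 f1 W2 f2"
  shows "vanishing_order (Suc r) (\<lambda>w. f2 w - f1 w)"
  unfolding vanishing_order_def
proof
  fix x
  obtain U df where U: "open U" "UNIV \<times> {0} \<subseteq> U" "continuous_on U df"
    "\<And>x h. (x, h) \<in> U \<Longrightarrow> f2 (x, h) - f1 (x, h) = h ^ (r + 1) *\<^sub>R df (x, h)"
    using assms unfolding contact_order_def by blast
  have "(x, 0) \<in> U"
    using U(2) by auto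
  then have "isCont df (x, 0)"
    using U(1,3) by (simp add: continuous_on_eq_continuous_at)
  then have "(df \<longlongrightarrow> df (x, 0)) (at (x, 0) within {w. snd w \<noteq> 0})"
    by (auto simp: isCont_def intro: tendsto_within_subset)
  moreover have "\<forall>\<^sub>F w in at (x, 0) within {w. snd w \<noteq> 0}. df w = (f2 w - f1 w) /\<^sub>R snd w ^ Suc r"
    using eventually_at_within_nbhd[OF U(1,2), of x "{w. snd w \<noteq> 0}"]
    unfolding eventually_at_filter
  proof eventually_elim
    case (elim w)
    then show ?case
      using U(4)[of "fst w" "snd w"] by (auto simp del: power_Suc)
  qed
  ultimately have "((\<lambda>w. (f2 w - f1 w) /\<^sub>R snd w ^ Suc r) \<longlongrightarrow> df (x, 0))
      (at (x, 0) within {w. snd w \<noteq> 0})"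
    by (rule Lim_transform_eventually)
  then show "\<exists>l. ((\<lambda>w. (f2 w - f1 w) /\<^sub>R snd w ^ Suc r) \<longlongrightarrow> l) (at (x, 0) within {w. snd w \<noteq> 0})"
    by blast
qed

text \<open>The factor is the quotient off the slice and its limit on it. The limit at
  \<open>(x0, 0)\<close> controls the quotient on a full neighbourhood off the slice; passing to
  limits at neighbouring slice points controls \<open>l\<close> there as well.\<close>

lemma vanishing_order_imp_contact_order:
  fixes f1 f2 :: "'x::real_normed_vector \<times> real \<Rightarrow> 'y::real_normed_vector"
  assumes W1: "open W1" "UNIV \<times> {0} \<subseteq> W1" "continuous_on W1 f1"
    and W2: "open W2" "UNIV \<times> {0} \<subseteq> W2" "continuous_on W2 f2"
    and van: "vanishing_order (Suc r) (\<lambda>w. f2 w - f1 w)"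
  shows "contact_order r W1 f1 W2 f2"
proof -
  let ?F = "\<lambda>x::'x. at (x, 0::real) within {w. snd w \<noteq> 0}"
  define U where "U = W1 \<inter> W2"
  have U: "open U" "UNIV \<times> {0} \<subseteq> U"
    using W1 W2 by (auto simp: U_def)
  define q where "q w = (f2 w - f1 w) /\<^sub>R snd w ^ Suc r" for w
  have "\<forall>x. \<exists>l. (q \<longlongrightarrow> l) (?F x)"
    using van unfolding vanishing_order_def q_def .
  then obtain l where l: "\<And>x. (q \<longlongrightarrow> l x) (?F x)"
    by metis
  define df where "df w = (if snd w = 0 then l (fst w) else q w)" for w
  have contd: "continuous_on U (\<lambda>w. f2 w - f1 w)"
    using W1(3) W2(3) unfolding U_def
    by (intro continuous_on_diff) (auto intro: continuous_on_subset)
  have "isCont df w0" if w0: "w0 \<in> U" for w0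
  proof (cases "snd w0 = 0")
    case False
    have "open {w :: 'x \<times> real. snd w \<noteq> 0}"
      by (intro open_Collect_neq continuous_intros)
    moreover have "isCont (\<lambda>w. f2 w - f1 w) w0"
      using contd U(1) w0 by (simp only: continuous_on_eq_continuous_at)
    then have "isCont q w0"
      unfolding q_def using False
      by (intro continuous_scaleR continuous_at_within_inverse continuous_power continuous_snd
          continuous_ident) auto
    ultimately show ?thesis
      using False by (subst isCont_cong[of _ q])
        (auto simp: df_def eventually_nhds intro!: exI[of _ "{w. snd w \<noteq> 0}"])
  next
    case True
    then obtain x0 where x0: "w0 = (x0, 0)"
      by (metis prod.collapse)
    show ?thesis
      unfolding continuous_at_eps_delta
    proof (intro allI impI)
      fix e :: real assume e: "e > 0"
      \<comment> \<open>Halved because a strict bound on the quotients becomes only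
        \<open>\<le> e / 2\<close> for their limits.\<close>
      then have "e / 2 > 0"
        by simp
      from tendsto_at_within_snd_nonzeroD[OF l[of x0] this]
      obtain d where d: "d > 0"
        "\<And>w. snd w \<noteq> 0 \<Longrightarrow> dist w w0 < d \<Longrightarrow> dist (q w) (l x0) < e / 2"
        unfolding x0 by blast
      have "dist (df w) (df w0) < e" if w: "dist w w0 < d" for w
      proof (cases "snd w = 0")
        case False
        then show ?thesis
          using d(2)[OF _ w] e by (simp add: df_def x0)
      next
        case True
        then obtain x where x: "w = (x, 0)"
          by (metis prod.collapse)
        have "\<forall>\<^sub>F w' in ?F x. w' \<in> ball w0 d"
          using w by (auto simp: eventually_at_topological x dist_commute intro!: exI[of _ "ball w0 d"])
        moreover have "\<forall>\<^sub>F w' in ?F x. snd w' \<noteq> 0"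
          by (simp add: eventually_at_filter)
        ultimately have "\<forall>\<^sub>F w' in ?F x. dist (q w') (l x0) \<le> e / 2"
        proof eventually_elim
          case (elim w')
          then show ?case
            using d(2)[of w'] by (simp add: dist_commute)
        qed
        moreover have "((\<lambda>w'. dist (q w') (l x0)) \<longlongrightarrow> dist (l x) (l x0)) (?F x)"
          by (intro tendsto_dist l tendsto_const)
        ultimately have "dist (l x) (l x0) \<le> e / 2"
          using tendsto_upperbound[OF _ _ at_within_snd_nonzero_neq_bot] by blast
        then show ?thesis
          using e by (simp add: df_def x x0)
      qed
      with d(1) show "\<exists>d>0. \<forall>w. dist w w0 < d \<longrightarrow> dist (df w) (df w0) < e"
        by blast
    qed
  qed
  then have "continuous_on U df"
    by (simp add: continuous_at_imp_continuous_on)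
  moreover have "f2 (x, h) - f1 (x, h) = h ^ (r + 1) *\<^sub>R df (x, h)" if xh: "(x, h) \<in> U" for x h
  proof (cases "h = 0")
    case False
    then show ?thesis
      by (simp add: df_def q_def del: power_Suc)
  next
    \<comment> \<open>The limit does not see the values on the slice. There the identity requires
      \<open>f1 = f2\<close>, which continuity forces since the exponent \<open>Suc r\<close> is
      positive.\<close>
    case True
    have "((\<lambda>w. snd w ^ Suc r *\<^sub>R q w) \<longlongrightarrow> snd (x, 0::real) ^ Suc r *\<^sub>R l x) (?F x)"
      by (intro tendsto_intros l)
    then have "((\<lambda>w. snd w ^ Suc r *\<^sub>R q w) \<longlongrightarrow> 0) (?F x)"
      by simp
    moreover have "\<forall>\<^sub>F w in ?F x. snd w ^ Suc r *\<^sub>R q w = f2 w - f1 w"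
      by (simp add: eventually_at_filter q_def del: power_Suc)
    ultimately have "((\<lambda>w. f2 w - f1 w) \<longlongrightarrow> 0) (?F x)"
      by (rule Lim_transform_eventually)
    moreover have "isCont (\<lambda>w. f2 w - f1 w) (x, h)"
      using contd U(1) xh by (simp only: continuous_on_eq_continuous_at)
    then have "((\<lambda>w. f2 w - f1 w) \<longlongrightarrow> f2 (x, h) - f1 (x, h)) (?F x)"
      unfolding isCont_def True by (rule tendsto_within_subset) simp
    ultimately have "f2 (x, h) - f1 (x, h) = 0"
      using tendsto_unique[OF at_within_snd_nonzero_neq_bot] by blast
    then show ?thesis
      using True by simp
  qed
  ultimately show ?thesis
    unfolding contact_order_def using U by (intro exI[of _ U] exI[of _ df]) (auto simp: U_def)
qed

section \<open>Taylor expansion in \<open>h\<close> and derivatives along the slice\<close>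

definition deriv_h :: "('x::real_normed_vector \<times> real \<Rightarrow> real) \<Rightarrow> 'x \<times> real \<Rightarrow> real" where
  "deriv_h f w = frechet_derivative f (at w) (0, 1)"

lemma smooth_on_deriv_h_funpow: "smooth_on W f \<Longrightarrow> smooth_on W ((deriv_h ^^ k) f)"
  by (induction k) (simp_all add: deriv_h_def[abs_def] smooth_on_frechet_derivative)

text \<open>With the Lagrange remainder the quotient at \<open>(y, h)\<close> equals the
  \<open>n\<close>-th derivative at some \<open>(y, t)\<close> with
  \<open>\<bar>t\<bar> \<le> \<bar>h\<bar>\<close>, divided by \<open>fact n\<close>, and this point
  is no farther from \<open>(x, 0)\<close> than \<open>(y, h)\<close>. The expansion is centred at
  \<open>(y, 0)\<close>, so the lower coefficients must vanish on the whole slice and not just at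
  \<open>x\<close>.\<close>

lemma taylor_quotient_tendsto:
  fixes f :: "'x::real_normed_vector \<times> real \<Rightarrow> real"
  assumes W: "open W" "UNIV \<times> {0} \<subseteq> W" and f: "smooth_on W f"
    and zero: "\<And>k x. k < n \<Longrightarrow> (deriv_h ^^ k) f (x, 0) = 0"
  shows "((\<lambda>w. f w /\<^sub>R snd w ^ n) \<longlongrightarrow> (deriv_h ^^ n) f (x, 0) / fact n)
    (at (x, 0) within {w. snd w \<noteq> 0})"
proof (rule tendstoI)
  fix e :: real assume e: "e > 0"
  define g where "g k = (deriv_h ^^ k) f" for k
  have g: "smooth_on W (g k)" for k
    unfolding g_def using f by (rule smooth_on_deriv_h_funpow)
  have xW: "(x, 0) \<in> W"
    using W(2) by auto
  have "isCont (\<lambda>w. g n w / fact n) (x, 0)"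
    using smooth_on_continuous[OF g] W(1) xW
    by (intro continuous_intros) (auto simp: continuous_on_eq_continuous_at)
  then obtain d1 where d1: "d1 > 0"
    "\<And>w. dist w (x, 0) < d1 \<Longrightarrow> dist (g n w / fact n) (g n (x, 0) / fact n) < e"
    using e unfolding continuous_at_eps_delta by metis
  obtain d2 where d2: "d2 > 0" "ball (x, 0) d2 \<subseteq> W"
    using W(1) xW unfolding open_contains_ball by blast
  have "dist (f w /\<^sub>R snd w ^ n) ((deriv_h ^^ n) f (x, 0) / fact n) < e"
    if w: "snd w \<noteq> 0" "dist w (x, 0) < min d1 d2" for w
  proof -
    obtain y h where yh: "w = (y, h)"
      by (cases w)
    have near: "dist (y, t) (x, 0) < min d1 d2" if "\<bar>t\<bar> \<le> \<bar>h\<bar>" for t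
    proof -
      have "dist (y, t) (x, 0) \<le> dist (y, h) (x, 0)"
        using that by (simp add: dist_Pair_Pair abs_le_square_iff)
      then show ?thesis
        using w(2) by (simp add: yh)
    qed
    have "DERIV (\<lambda>t. g m (y, t)) t :> g (Suc m) (y, t)" if "\<bar>t\<bar> \<le> \<bar>h\<bar>" for m t
    proof -
      have "(y, t) \<in> W"
        using near[OF that] d2 by (auto simp: dist_commute)
      then have "(g m has_derivative frechet_derivative (g m) (at (y, t))) (at (y, t))"
        by (rule smooth_on_has_derivative[OF g])
      moreover have "((\<lambda>t. (y, t)) has_derivative (\<lambda>s. (0, s))) (at t)"
        by (rule has_derivative_Pair[OF has_derivative_const has_derivative_ident])
      ultimately have D: "((\<lambda>t. g m (y, t)) has_derivative
          (\<lambda>s. frechet_derivative (g m) (at (y, t)) (0, s))) (at t)"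
        using has_derivative_compose[of "\<lambda>t. (y, t)" "\<lambda>s. (0, s)" t UNIV "g m"] by simp
      have "frechet_derivative (g m) (at (y, t)) (0, s) = g (Suc m) (y, t) * s" for s
        using linear_cmul[OF has_derivative_linear[OF D], of s 1]
        by (simp add: g_def deriv_h_def mult.commute)
      with D show ?thesis
        by (simp add: has_field_derivative_def fun_eq_iff)
    qed
    then have "\<exists>t. \<bar>t\<bar> \<le> \<bar>h\<bar> \<and>
        g 0 (y, h) = (\<Sum>m<n. g m (y, 0) / fact m * h ^ m) + g n (y, t) / fact n * h ^ n"
      by (intro Maclaurin_bi_le[of "\<lambda>m t. g m (y, t)"]) auto
    then obtain t where t: "\<bar>t\<bar> \<le> \<bar>h\<bar>"
      "g 0 (y, h) = (\<Sum>m<n. g m (y, 0) / fact m * h ^ m) + g n (y, t) / fact n * h ^ n"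
      by blast
    have "f w /\<^sub>R snd w ^ n = g n (y, t) / fact n"
      using t(2) w(1) zero by (simp add: yh g_def)
    then show ?thesis
      using d1(2)[of "(y, t)"] near[OF t(1)] by (simp add: g_def)
  qed
  then show "\<forall>\<^sub>F w in at (x, 0) within {w. snd w \<noteq> 0}.
      dist (f w /\<^sub>R snd w ^ n) ((deriv_h ^^ n) f (x, 0) / fact n) < e"
    unfolding eventually_at using d1(1) d2(1) by (intro exI[of _ "min d1 d2"]) auto
qed

lemma vanishing_order_less_tendsto:
  assumes "vanishing_order n f" "k < n"
  shows "((\<lambda>w. f w /\<^sub>R snd w ^ k) \<longlongrightarrow> 0) (at (x, 0) within {w. snd w \<noteq> 0})"
proof -
  let ?F = "at (x, 0) within {w. snd w \<noteq> 0}"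
  obtain l where l: "((\<lambda>w. f w /\<^sub>R snd w ^ n) \<longlongrightarrow> l) ?F"
    using assms(1) unfolding vanishing_order_def by blast
  have zero: "snd (x, 0 :: real) ^ (n - k) *\<^sub>R l = 0"
    using assms(2) by simp
  have "((\<lambda>w. snd w ^ (n - k) *\<^sub>R (f w /\<^sub>R snd w ^ n)) \<longlongrightarrow> 0) ?F"
    by (rule tendsto_eq_rhs[OF _ zero]) (intro tendsto_intros l)
  moreover have "\<forall>\<^sub>F w in ?F. snd w ^ (n - k) *\<^sub>R (f w /\<^sub>R snd w ^ n) = f w /\<^sub>R snd w ^ k"
    using assms(2) by (simp add: eventually_at_filter power_diff field_simps)
  ultimately show ?thesis
    by (rule Lim_transform_eventually)
qed

text \<open>By \<open>taylor_quotient_tendsto\<close> it is enough that the first \<open>n\<close>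
  Taylor coefficients in \<open>h\<close> of the derivative vanish on the slice. Strong induction
  supplies the lower coefficients, so that the quotient by \<open>h ^ k\<close> has a limit, which
  is then shown to be \<open>0\<close>.\<close>

lemma vanishing_order_derivative:
  fixes f :: "'x::real_normed_vector \<times> real \<Rightarrow> real"
  assumes W: "open W" "UNIV \<times> {0} \<subseteq> W" and f: "smooth_on W f" and van: "vanishing_order n f"
  shows "vanishing_order n (\<lambda>w. frechet_derivative f (at w) (u, 0))"
proof -
  define F where "F w = frechet_derivative f (at w) (u, 0)" for w
  have F: "smooth_on W F"
    unfolding F_def using f by (rule smooth_on_frechet_derivative)
  have "(deriv_h ^^ k) F (x, 0) = 0" if "k < n" for k x
    using that
  proof (induction k arbitrary: x rule: less_induct)
    case (less k)
    show ?case
    \<comment> \<open>If \<open>F / h^k\<close> had a nonzero limit \<open>c\<close>, the mean value theorem along \<open>u\<close> would keep a difference of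
      two values of \<open>f / h^k\<close> away from \<open>0\<close>, although both tend to \<open>0\<close>.\<close>
    proof (rule ccontr)
      define c where "c = (deriv_h ^^ k) F (x, 0) / fact k"
      assume "(deriv_h ^^ k) F (x, 0) \<noteq> 0"
      then have c: "\<bar>c\<bar> / 2 > 0"
        by (simp add: c_def)
      have "((\<lambda>w. F w /\<^sub>R snd w ^ k) \<longlongrightarrow> c) (at (x, 0) within {w. snd w \<noteq> 0})"
        unfolding c_def using less by (intro taylor_quotient_tendsto[OF W F]) auto
      from tendsto_at_within_snd_nonzeroD[OF this c] obtain d1 where d1: "d1 > 0"
        "\<And>w. snd w \<noteq> 0 \<Longrightarrow> dist w (x, 0) < d1 \<Longrightarrow> dist (F w /\<^sub>R snd w ^ k) c < \<bar>c\<bar> / 2"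
        by blast
      obtain d2 where d2: "d2 > 0" "ball (x, 0) d2 \<subseteq> W"
        using W open_contains_ball[of W] by blast
      define d where "d = min d1 d2"
      \<comment> \<open>The segment from \<open>x\<close> along \<open>u\<close> stays within
        \<open>d / 2\<close>, and \<open>h < d / 2\<close> uses the other half of the radius. The
        summand \<open>1\<close> admits \<open>u = 0\<close>. The step does not depend on
        \<open>h\<close>, so the lower bound below survives as \<open>h\<close> tends to
        \<open>0\<close>.\<close>
      define t where "t = d / 2 / (norm u + 1)"
      have d: "d > 0"
        using d1 d2 by (simp add: d_def)
      have t: "t > 0" "t * norm u < d / 2"
      proof -
        have n1: "norm u + 1 > 0"
          by (simp add: add_nonneg_pos)
        then show t0: "t > 0"
          using d by (simp add: t_def)
        have "t * (norm u + 1) = d / 2"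
          using n1 by (simp add: t_def del: divide_divide_eq_left)
        then show "t * norm u < d / 2"
          using t0 by (simp add: algebra_simps)
      qed
      have lower: "t * (\<bar>c\<bar> / 2) \<le> \<bar>f (x + t *\<^sub>R u, h) /\<^sub>R h ^ k - f (x, h) /\<^sub>R h ^ k\<bar>"
        if h: "0 < h" "h < d / 2" for h
      proof -
        have near: "dist (x + s *\<^sub>R u, h) (x, 0) < d" if "0 \<le> s" "s \<le> t" for s
        proof -
          have "dist (x + s *\<^sub>R u, h) (x, 0) \<le> norm (s *\<^sub>R u) + norm h"
            by (metis add_diff_cancel_left' diff_Pair diff_zero dist_norm norm_Pair_le)
          also have "\<dots> \<le> t * norm u + h"
            using that h by (simp add: mult_right_mono)
          also have "\<dots> < d"
            using t(2) h(2) by simp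
          finally show ?thesis .
        qed
        have "DERIV (\<lambda>s. f (x + s *\<^sub>R u, h)) s :> F (x + s *\<^sub>R u, h)" if "0 \<le> s" "s \<le> t" for s
        proof -
          have "(x + s *\<^sub>R u, h) \<in> W"
            using near[OF that] d2 by (auto simp: d_def dist_commute)
          then have "(f has_derivative frechet_derivative f (at (x + s *\<^sub>R u, h))) (at (x + s *\<^sub>R u, h))"
            by (rule smooth_on_has_derivative[OF f])
          moreover have "((\<lambda>s. (x + s *\<^sub>R u, h)) has_derivative (\<lambda>r. (r *\<^sub>R u, 0))) (at s)"
            by (auto intro!: derivative_eq_intros)
          ultimately have D: "((\<lambda>s. f (x + s *\<^sub>R u, h)) has_derivative
              (\<lambda>r. frechet_derivative f (at (x + s *\<^sub>R u, h)) (r *\<^sub>R u, 0))) (at s)"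
            using has_derivative_compose[of "\<lambda>s. (x + s *\<^sub>R u, h)" "\<lambda>r. (r *\<^sub>R u, 0)" s UNIV f] by simp
          have "frechet_derivative f (at (x + s *\<^sub>R u, h)) (r *\<^sub>R u, 0) = F (x + s *\<^sub>R u, h) * r" for r
            using linear_cmul[OF has_derivative_linear[OF D], of r 1]
            by (simp add: F_def mult.commute)
          with D show ?thesis
            by (simp add: has_field_derivative_def fun_eq_iff)
        qed
        from MVT2[OF t(1) this] obtain s where s: "0 < s" "s < t"
          "f (x + t *\<^sub>R u, h) - f (x, h) = t * F (x + s *\<^sub>R u, h)"
          by auto
        have "dist (F (x + s *\<^sub>R u, h) /\<^sub>R h ^ k) c < \<bar>c\<bar> / 2"
          using d1(2)[of "(x + s *\<^sub>R u, h)"] near[of s] s(1,2) h(1) by (simp add: d_def)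
        then have "\<bar>c\<bar> / 2 \<le> \<bar>F (x + s *\<^sub>R u, h) /\<^sub>R h ^ k\<bar>"
          using abs_triangle_ineq2[of c "F (x + s *\<^sub>R u, h) /\<^sub>R h ^ k"]
          unfolding dist_real_def abs_minus_commute[of _ c] by linarith
        then have "t * (\<bar>c\<bar> / 2) \<le> t * \<bar>F (x + s *\<^sub>R u, h) /\<^sub>R h ^ k\<bar>"
          using t(1) by (intro mult_left_mono) auto
        also have "\<dots> = \<bar>(f (x + t *\<^sub>R u, h) - f (x, h)) /\<^sub>R h ^ k\<bar>"
          using t(1) by (simp add: s(3) abs_mult)
        finally show ?thesis
          by (simp add: right_diff_distrib)
      qed
      \<comment> \<open>Half of the lower bound: two numbers of modulus below \<open>e\<close>
        differ by less than \<open>2 * e\<close>.\<close>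
      define e where "e = t * (\<bar>c\<bar> / 2) / 2"
      have e: "e > 0"
        using t(1) c by (simp add: e_def)
      have small: "\<exists>b>0. \<forall>h. 0 < h \<and> h < b \<longrightarrow> \<bar>f (y, h) /\<^sub>R h ^ k\<bar> < e" for y
      proof -
        obtain b where b: "b > 0"
          "\<And>w. snd w \<noteq> 0 \<Longrightarrow> dist w (y, 0) < b \<Longrightarrow> dist (f w /\<^sub>R snd w ^ k) 0 < e"
          using tendsto_at_within_snd_nonzeroD[OF vanishing_order_less_tendsto[OF van less.prems] e]
          by blast
        have "\<bar>f (y, h) /\<^sub>R h ^ k\<bar> < e" if "0 < h" "h < b" for h
          using b(2)[of "(y, h)"] that by (simp add: dist_Pair_Pair)
        with b(1) show ?thesis
          by blast
      qed
      obtain b where b: "b > 0" "\<And>h. 0 < h \<Longrightarrow> h < b \<Longrightarrow> \<bar>f (x, h) /\<^sub>R h ^ k\<bar> < e"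
        using small by metis
      obtain b' where b': "b' > 0" "\<And>h. 0 < h \<Longrightarrow> h < b' \<Longrightarrow> \<bar>f (x + t *\<^sub>R u, h) /\<^sub>R h ^ k\<bar> < e"
        using small by metis
      define h where "h = min (d / 2) (min b b') / 2"
      have h: "0 < h" "h < d / 2" "h < b" "h < b'"
        using d b(1) b'(1) by (auto simp: h_def min_def)
      show False
        using lower[OF h(1,2)] b(2)[OF h(1,3)] b'(2)[OF h(1,4)]
          abs_triangle_ineq4[of "f (x + t *\<^sub>R u, h) /\<^sub>R h ^ k" "f (x, h) /\<^sub>R h ^ k"]
        unfolding e_def by linarith
    qed
  qed
  then have "\<exists>l. ((\<lambda>w. F w /\<^sub>R snd w ^ n) \<longlongrightarrow> l) (at (x, 0) within {w. snd w \<noteq> 0})" for x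
    using taylor_quotient_tendsto[OF W F, of n x] by auto
  then show ?thesis
    unfolding vanishing_order_def F_def[symmetric] by blast
qed

section \<open>Contact of Legendre transforms and flows\<close>

text \<open>Both points \<open>u t\<close> and \<open>v t\<close> move, and neither needs to be
  \<open>w0\<close>, so differentiability at \<open>w0\<close> alone would not control the
  difference; the strict form does.\<close>

lemma strict_derivative_tendsto:
  fixes q :: "'x::euclidean_space \<Rightarrow> 'y::real_normed_vector"
  assumes V: "open V" and q: "smooth_on V q" and w0: "w0 \<in> V"
    and u: "(u \<longlongrightarrow> w0) F" and v: "(v \<longlongrightarrow> w0) F"
    and m: "((\<lambda>t. (u t - v t) /\<^sub>R s t) \<longlongrightarrow> m) F"
  shows "((\<lambda>t. (q (u t) - q (v t)) /\<^sub>R s t) \<longlongrightarrow> frechet_derivative q (at w0) m) F"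
proof -
  let ?D = "frechet_derivative q (at w0)"
  have D: "bounded_linear ?D"
    using smooth_on_has_derivative[OF q w0] by (rule has_derivative_bounded_linear)
  have "((\<lambda>t. (q (u t) - q (v t)) /\<^sub>R s t - ?D ((u t - v t) /\<^sub>R s t)) \<longlongrightarrow> 0) F"
  proof (rule tendstoI)
    fix e :: real assume "e > 0"
    \<comment> \<open>Eventually bounds the convergent quotient, so the tolerance
      \<open>e / B\<close> yields a total error below \<open>e\<close>.\<close>
    define B where "B = norm m + 1"
    have B: "B > 0"
      by (simp add: B_def add_nonneg_pos)
    then have "e / B > 0"
      using \<open>e > 0\<close> by simp
    from strict_derivative[OF V q w0 this] obtain d where d: "d > 0"
      "\<And>x y. x \<in> ball w0 d \<Longrightarrow> y \<in> ball w0 d \<Longrightarrow>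
        norm (q x - q y - ?D (x - y)) \<le> e / B * norm (x - y)"
      by metis
    have "\<forall>\<^sub>F t in F. dist (u t) w0 < d" "\<forall>\<^sub>F t in F. dist (v t) w0 < d"
      using u v d(1) by (auto dest: tendstoD)
    moreover have "\<forall>\<^sub>F t in F. norm ((u t - v t) /\<^sub>R s t) < B"
      using order_tendstoD(2)[OF tendsto_norm[OF m], of B] by (simp add: B_def)
    ultimately show "\<forall>\<^sub>F t in F. dist ((q (u t) - q (v t)) /\<^sub>R s t - ?D ((u t - v t) /\<^sub>R s t)) 0 < e"
    proof eventually_elim
      case (elim t)
      have "(q (u t) - q (v t)) /\<^sub>R s t - ?D ((u t - v t) /\<^sub>R s t)
          = (q (u t) - q (v t) - ?D (u t - v t)) /\<^sub>R s t"
        by (simp add: linear_cmul[OF bounded_linear.linear[OF D]] flip: scaleR_diff_right)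
      also have "norm \<dots> \<le> \<bar>inverse (s t)\<bar> * (e / B * norm (u t - v t))"
        unfolding norm_scaleR using elim d(2)[of "u t" "v t"]
        by (intro mult_left_mono) (auto simp: dist_commute)
      also have "\<dots> = e / B * norm ((u t - v t) /\<^sub>R s t)"
        by simp
      also have "\<dots> < e / B * B"
        using elim(3) \<open>e / B > 0\<close> by (rule mult_strict_left_mono)
      also have "\<dots> = e"
        using B by simp
      finally show ?case
        by (simp only: dist_norm diff_zero)
    qed
  qed
  from tendsto_add[OF this bounded_linear.tendsto[OF D m]] show ?thesis
    by simp
qed

text \<open>Here \<open>l1\<close>, \<open>l2\<close> play the minus and \<open>p1\<close>,
  \<open>p2\<close> the plus transforms. The limit at \<open>(x, 0)\<close> is drawn from the limits
  at \<open>(y, 0) = K2 (x, 0)\<close>, so the contact hypotheses are used at another point of the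
  slice.\<close>

lemma vanishing_order_compose_inverse:
  fixes l1 l2 :: "'x::euclidean_space \<times> real \<Rightarrow> 'x" and p1 p2 :: "'x \<times> real \<Rightarrow> 'y::euclidean_space"
  defines "L1 \<equiv> \<lambda>w. (l1 w, snd w)" and "L2 \<equiv> \<lambda>w. (l2 w, snd w)"
  assumes p1: "smooth_on U1 p1"
    and U1: "UNIV \<times> {0} \<subseteq> U1" "UNIV \<times> {0} \<subseteq> L1 ` U1" "diffeo_between U1 (L1 ` U1) L1"
    and U2: "UNIV \<times> {0} \<subseteq> U2" "UNIV \<times> {0} \<subseteq> L2 ` U2" "diffeo_between U2 (L2 ` U2) L2"
    and l: "vanishing_order n (\<lambda>w. l2 w - l1 w)" and p: "vanishing_order n (\<lambda>w. p2 w - p1 w)"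
    and n: "n > 0"
  shows "vanishing_order n (\<lambda>w. p2 (inv_into U2 L2 w) - p1 (inv_into U1 L1 w))"
  unfolding vanishing_order_def
proof
  fix x :: 'x
  let ?F = "at (x, 0 :: real) within {w. snd w \<noteq> 0}"
  define K1 where "K1 = inv_into U1 L1"
  define K2 where "K2 = inv_into U2 L2"
  define V1 where "V1 = L1 ` U1"
  define V2 where "V2 = L2 ` U2"
  have V1: "open U1" "open V1" "smooth_on V1 K1" "UNIV \<times> {0} \<subseteq> V1" "K1 ` V1 \<subseteq> U1"
    and KL1: "\<And>w. w \<in> U1 \<Longrightarrow> K1 (L1 w) = w"
    using U1 by (auto simp: diffeo_between_def V1_def K1_def bij_betw_def inv_into_into)
  have V2: "open U2" "open V2" "smooth_on V2 K2" "UNIV \<times> {0} \<subseteq> V2"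
    and LK2: "\<And>w. w \<in> V2 \<Longrightarrow> L2 (K2 w) = w"
    using U2 by (auto simp: diffeo_between_def V2_def K2_def bij_betw_def f_inv_into_f)
  have snd_K2: "snd (K2 w) = snd w" if "w \<in> V2" for w
    using LK2[OF that] by (metis L2_def snd_conv)
  have x: "(x, 0) \<in> V1" "(x, 0) \<in> V2"
    using V1(4) V2(4) by auto
  have "snd (K2 (x, 0)) = 0"
    using snd_K2[OF x(2)] by simp
  then obtain y where y: "K2 (x, 0) = (y, 0)"
    by (metis prod.collapse)
  have evV2: "\<forall>\<^sub>F w in ?F. w \<in> V2"
    by (rule eventually_at_within_nbhd[OF V2(2,4)])
  have "isCont K2 (x, 0)"
    using smooth_on_continuous[OF V2(3)] V2(2) x(2) by (simp add: continuous_on_eq_continuous_at)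
  then have limK2: "(K2 \<longlongrightarrow> (y, 0)) ?F"
    unfolding isCont_def y by (rule tendsto_within_subset) simp
  have nz: "\<forall>\<^sub>F w in ?F. snd w \<noteq> 0"
    by (simp add: eventually_at_filter)
  \<comment> \<open>\<open>K2\<close> preserves \<open>h\<close>, so points off the slice stay off
    it and a limit at \<open>(y, 0)\<close> can be composed with \<open>K2\<close>.\<close>
  have filterK2: "filterlim K2 (at (y, 0) within {w. snd w \<noteq> 0}) ?F"
    unfolding filterlim_at
  proof
    show "\<forall>\<^sub>F w in ?F. K2 w \<in> {w. snd w \<noteq> 0} \<and> K2 w \<noteq> (y, 0)"
      using evV2 nz
    proof eventually_elim
      case (elim w)
      then show ?case
        using snd_K2[OF elim(1)] by auto
    qed
  qed (rule limK2)
  have along_K2: "\<exists>a. ((\<lambda>w. f (K2 w) /\<^sub>R snd w ^ n) \<longlongrightarrow> a) ?F"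
    if "vanishing_order n f" for f :: "'x \<times> real \<Rightarrow> 'z::real_normed_vector"
  proof -
    obtain a where "((\<lambda>w. f w /\<^sub>R snd w ^ n) \<longlongrightarrow> a) (at (y, 0) within {w. snd w \<noteq> 0})"
      using \<open>vanishing_order n f\<close> unfolding vanishing_order_def by blast
    then have "((\<lambda>w. f (K2 w) /\<^sub>R snd (K2 w) ^ n) \<longlongrightarrow> a) ?F"
      using filterK2 by (rule filterlim_compose)
    moreover have "\<forall>\<^sub>F w in ?F. f (K2 w) /\<^sub>R snd (K2 w) ^ n = f (K2 w) /\<^sub>R snd w ^ n"
      using evV2 by (rule eventually_mono) (simp add: snd_K2)
    ultimately have "((\<lambda>w. f (K2 w) /\<^sub>R snd w ^ n) \<longlongrightarrow> a) ?F"
      by (rule Lim_transform_eventually)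
    then show ?thesis ..
  qed
  obtain a where a: "((\<lambda>w. (p2 (K2 w) - p1 (K2 w)) /\<^sub>R snd w ^ n) \<longlongrightarrow> a) ?F"
    using along_K2[OF p] by blast
  obtain m where m: "((\<lambda>w. (l2 (K2 w) - l1 (K2 w)) /\<^sub>R snd w ^ n) \<longlongrightarrow> m) ?F"
    using along_K2[OF l] by blast
  have "((\<lambda>w. (- ((l2 (K2 w) - l1 (K2 w)) /\<^sub>R snd w ^ n), 0 :: real)) \<longlongrightarrow> (- m, 0)) ?F"
    by (intro tendsto_Pair tendsto_minus m tendsto_const)
  moreover have "\<forall>\<^sub>F w in ?F. (- ((l2 (K2 w) - l1 (K2 w)) /\<^sub>R snd w ^ n), 0) = (L1 (K2 w) - w) /\<^sub>R snd w ^ n"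
    using evV2
  proof eventually_elim
    case (elim w)
    have "L1 (K2 w) - L2 (K2 w) = (- (l2 (K2 w) - l1 (K2 w)), 0)"
      by (simp add: L1_def L2_def)
    then show ?case
      by (simp add: LK2[OF elim] scaleR_diff_right)
  qed
  ultimately have m': "((\<lambda>w. (L1 (K2 w) - w) /\<^sub>R snd w ^ n) \<longlongrightarrow> (- m, 0)) ?F"
    by (rule Lim_transform_eventually)
  have idlim: "((\<lambda>w. w) \<longlongrightarrow> (x, 0)) ?F"
    by (rule tendsto_ident_at)
  \<comment> \<open>Multiplying the quotient back by \<open>h ^ n\<close>, which tends to
    \<open>0\<close> because \<open>n > 0\<close>, shows that \<open>L1 (K2 w)\<close> tends to
    \<open>(x, 0)\<close>; strict differentiability needs this.\<close>
  have "((\<lambda>w. snd w ^ n *\<^sub>R ((L1 (K2 w) - w) /\<^sub>R snd w ^ n)) \<longlongrightarrow> snd (x, 0 :: real) ^ n *\<^sub>R (- m, 0)) ?F"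
    by (intro tendsto_scaleR m' tendsto_power tendsto_snd idlim)
  moreover have "\<forall>\<^sub>F w in ?F. snd w ^ n *\<^sub>R ((L1 (K2 w) - w) /\<^sub>R snd w ^ n) = L1 (K2 w) - w"
    using nz by (rule eventually_mono) simp
  ultimately have "((\<lambda>w. L1 (K2 w) - w) \<longlongrightarrow> snd (x, 0 :: real) ^ n *\<^sub>R (- m, 0)) ?F"
    by (rule Lim_transform_eventually)
  from tendsto_add[OF this idlim] have L1K2: "((\<lambda>w. L1 (K2 w)) \<longlongrightarrow> (x, 0)) ?F"
    using n by (simp add: zero_power)
  define q where "q w = p1 (K1 w)" for w
  have q: "smooth_on V1 q"
    using p1 V1 unfolding smooth_on_def q_def by (auto intro: Ck_on_compose[OF V1(2,1,5)])
  have "((\<lambda>w. (q (L1 (K2 w)) - q w) /\<^sub>R snd w ^ n) \<longlongrightarrow> frechet_derivative q (at (x, 0)) (- m, 0)) ?F"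
    by (rule strict_derivative_tendsto[OF V1(2) q x(1) L1K2 idlim m'])
  from tendsto_add[OF a this]
  have "((\<lambda>w. (p2 (K2 w) - p1 (K2 w)) /\<^sub>R snd w ^ n + (q (L1 (K2 w)) - q w) /\<^sub>R snd w ^ n)
      \<longlongrightarrow> a + frechet_derivative q (at (x, 0)) (- m, 0)) ?F" .
  \<comment> \<open>\<open>U1\<close> and \<open>U2\<close> are unrelated, so \<open>K1\<close>
    undoes \<open>L1\<close> at \<open>K2 w\<close> only eventually, once \<open>K2 w\<close> is
    close to \<open>(y, 0)\<close>.\<close>
  moreover have "\<forall>\<^sub>F w in ?F. K2 w \<in> U1"
    using limK2 V1(1) by (rule topological_tendstoD) (use U1(1) in auto)
  then have "\<forall>\<^sub>F w in ?F. (p2 (K2 w) - p1 (K2 w)) /\<^sub>R snd w ^ n + (q (L1 (K2 w)) - q w) /\<^sub>R snd w ^ n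
      = (p2 (K2 w) - p1 (K1 w)) /\<^sub>R snd w ^ n"
    by (rule eventually_mono) (simp add: q_def KL1 flip: scaleR_add_right)
  ultimately have "((\<lambda>w. (p2 (K2 w) - p1 (K1 w)) /\<^sub>R snd w ^ n)
      \<longlongrightarrow> a + frechet_derivative q (at (x, 0)) (- m, 0)) ?F"
    by (rule Lim_transform_eventually)
  then show "\<exists>l. ((\<lambda>w. (p2 (inv_into U2 L2 w) - p1 (inv_into U1 L1 w)) /\<^sub>R snd w ^ n) \<longlongrightarrow> l) ?F"
    unfolding K1_def K2_def by blast
qed

section \<open>Legendre transforms in coordinates\<close>

lemma blinfun_eq_sum_Basis:
  fixes \<alpha> :: "'a::euclidean_space dual"
  shows "\<alpha> = (\<Sum>b\<in>Basis. blinfun_apply \<alpha> b *\<^sub>R blinfun_inner_left b)"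
proof (rule blinfun_eqI)
  fix x
  have "blinfun_apply \<alpha> x = (\<Sum>b\<in>Basis. (x \<bullet> b) *\<^sub>R blinfun_apply \<alpha> b)"
    by (rule linear_eq_sum_Basis) (rule bounded_linear.linear[OF blinfun.bounded_linear_right])
  then show "blinfun_apply \<alpha> x = blinfun_apply (\<Sum>b\<in>Basis. blinfun_apply \<alpha> b *\<^sub>R blinfun_inner_left b) x"
    by (simp add: blinfun.sum_left blinfun.scaleR_left mult.commute)
qed

lemma of_bidual_eq_sum_Basis:
  fixes \<Lambda> :: "'a::euclidean_space dual dual"
  shows "of_bidual \<Lambda> = (\<Sum>b\<in>Basis. blinfun_apply \<Lambda> (blinfun_inner_left b) *\<^sub>R b)"
proof -
  have "of_bidual \<Lambda> \<bullet> b = blinfun_apply \<Lambda> (blinfun_inner_left b)" for b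
    using of_bidual[of "blinfun_inner_left b" \<Lambda>] by simp
  then show ?thesis
    using euclidean_representation[of "of_bidual \<Lambda>"] by simp
qed

definition minus_map :: "'a::euclidean_space fdhs_family \<Rightarrow> 'a cotangent \<times> real \<Rightarrow> 'a cotangent" where
  "minus_map M w = fam_legendre_minus M (snd w) (fst w)"

definition plus_map :: "'a::euclidean_space fdhs_family \<Rightarrow> 'a cotangent \<times> real \<Rightarrow> 'a cotangent" where
  "plus_map M w = fam_legendre_plus M (snd w) (fst w)"

text \<open>\<open>Blinfun\<close> is inverted by \<open>blinfun_apply\<close> only on bounded
  linear maps; differentiability provides this.\<close>

lemma blinfun_apply_Blinfun_frechet_derivative:
  assumes "(f has_derivative f') (at x)"
  shows "blinfun_apply (Blinfun (frechet_derivative f (at x))) v = f' v"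
  using assms
  by (simp add: bounded_linear_Blinfun_apply has_derivative_bounded_linear
      frechet_derivative_at[OF assms, symmetric])

text \<open>The pairing of \<open>dH - \<phi>\<close> with \<open>v\<close>. All nontrivial
  coordinates of both Legendre transforms are of this form, so smoothness and contact need to be
  checked only for these scalar functions, to which Taylor's formula applies.\<close>

definition force_defect :: "'a::euclidean_space fdhs_family \<Rightarrow> 'a cotangent \<Rightarrow> 'a cotangent \<times> real \<Rightarrow> real" where
  "force_defect M v w = frechet_derivative (ham M) (at w) (v, 0) - blinfun_apply (force M w) v"

text \<open>On \<open>fdom M\<close> the partial derivative at fixed \<open>h\<close> is the full
  derivative restricted to the directions \<open>((v, 0), 0)\<close>. This trades \<open>D1\<close>
  for a derivative in a fixed direction, as \<open>Ck_on\<close> uses.\<close>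

lemma minus_map_eq:
  assumes M: "smooth_fdhs_family M" and w: "w \<in> fdom M"
  shows "minus_map M w = (fst (fst w), \<Sum>b\<in>Basis. force_defect M (b, 0) w *\<^sub>R blinfun_inner_left b)"
proof -
  obtain q p h where qph: "w = ((q, p), h)"
    by (metis surj_pair)
  have H: "(ham M has_derivative frechet_derivative (ham M) (at w)) (at ((q, p), h))"
    using smooth_on_has_derivative[OF _ w, of "ham M"] M by (simp add: smooth_fdhs_family_def qph)
  have "((\<lambda>q. ((q, p), h)) has_derivative (\<lambda>v. ((v, 0), 0))) (at q)"
    by (intro has_derivative_Pair has_derivative_ident has_derivative_const)
  then have "((\<lambda>q. ham M ((q, p), h)) has_derivative (\<lambda>v. frechet_derivative (ham M) (at w) ((v, 0), 0))) (at q)"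
    using has_derivative_compose[of "\<lambda>q. ((q, p), h)" "\<lambda>v. ((v, 0), 0)" q UNIV "ham M"
        "frechet_derivative (ham M) (at w)"] H by blast
  then have D: "blinfun_apply (D1 (\<lambda>z. ham M (z, h)) (q, p)) b = frechet_derivative (ham M) (at w) ((b, 0), 0)" for b
    unfolding D1_def by (simp add: blinfun_apply_Blinfun_frechet_derivative)
  have "bounded_linear (\<lambda>dq. blinfun_apply (force M w) (dq, 0))"
    by (intro bounded_linear_compose[OF blinfun.bounded_linear_right]
        bounded_linear_Pair bounded_linear_ident bounded_linear_zero)
  then have "blinfun_apply (form_q (\<lambda>z. force M (z, h)) (q, p)) b = blinfun_apply (force M w) (b, 0)" for b
    by (simp add: form_q_def bounded_linear_Blinfun_apply qph)
  with D have "blinfun_apply (D1 (\<lambda>z. ham M (z, h)) (q, p) - form_q (\<lambda>z. force M (z, h)) (q, p)) b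
      = force_defect M (b, 0) w" for b
    by (simp add: blinfun.diff_left force_defect_def)
  then show ?thesis
    using blinfun_eq_sum_Basis[of "D1 (\<lambda>z. ham M (z, h)) (q, p) - form_q (\<lambda>z. force M (z, h)) (q, p)"]
    by (simp add: minus_map_def fam_legendre_minus_def legendre_minus_def qph)
qed

lemma plus_map_eq:
  assumes M: "smooth_fdhs_family M" and w: "w \<in> fdom M"
  shows "plus_map M w = (\<Sum>b\<in>Basis. force_defect M (0, blinfun_inner_left b) w *\<^sub>R b, snd (fst w))"
proof -
  obtain q p h where qph: "w = ((q, p), h)"
    by (metis surj_pair)
  have H: "(ham M has_derivative frechet_derivative (ham M) (at w)) (at ((q, p), h))"
    using smooth_on_has_derivative[OF _ w, of "ham M"] M by (simp add: smooth_fdhs_family_def qph)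
  have "((\<lambda>p. ((q, p), h)) has_derivative (\<lambda>v. ((0, v), 0))) (at p)"
    by (intro has_derivative_Pair has_derivative_ident has_derivative_const)
  then have "((\<lambda>p. ham M ((q, p), h)) has_derivative (\<lambda>v. frechet_derivative (ham M) (at w) ((0, v), 0))) (at p)"
    using has_derivative_compose[of "\<lambda>p. ((q, p), h)" "\<lambda>v. ((0, v), 0)" p UNIV "ham M"
        "frechet_derivative (ham M) (at w)"] H by blast
  then have D: "blinfun_apply (D2 (\<lambda>z. ham M (z, h)) (q, p)) \<alpha> = frechet_derivative (ham M) (at w) ((0, \<alpha>), 0)" for \<alpha>
    unfolding D2_def by (simp add: blinfun_apply_Blinfun_frechet_derivative)
  have "bounded_linear (\<lambda>dp. blinfun_apply (force M w) (0, dp))"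
    by (intro bounded_linear_compose[OF blinfun.bounded_linear_right]
        bounded_linear_Pair bounded_linear_ident bounded_linear_zero)
  then have "blinfun_apply (form_p (\<lambda>z. force M (z, h)) (q, p)) \<alpha> = blinfun_apply (force M w) (0, \<alpha>)" for \<alpha>
    by (simp add: form_p_def bounded_linear_Blinfun_apply qph)
  with D have "blinfun_apply (D2 (\<lambda>z. ham M (z, h)) (q, p) - form_p (\<lambda>z. force M (z, h)) (q, p)) \<alpha>
      = force_defect M (0, \<alpha>) w" for \<alpha>
    by (simp add: blinfun.diff_left force_defect_def)
  then show ?thesis
    by (simp add: plus_map_def fam_legendre_plus_def legendre_plus_def of_bidual_eq_sum_Basis qph)
qed

lemma Ck_on_force_defect:
  assumes "smooth_fdhs_family M"
  shows "Ck_on k (fdom M) (force_defect M v)"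
proof -
  have M: "open (fdom M)" "smooth_on (fdom M) (ham M)" "smooth_on (fdom M) (force M)"
    using assms by (auto simp: smooth_fdhs_family_def)
  show ?thesis
    unfolding force_defect_def[abs_def]
    using smooth_on_frechet_derivative[OF M(2)] M(3)
    by (intro Ck_on_diff[OF M(1)] Ck_on_linear_compose[OF blinfun.bounded_linear_left M(1)])
      (auto simp: smooth_on_def)
qed

text \<open>\<open>ham\<close> enters through a derivative and needs the Taylor argument;
  \<open>force\<close> enters by evaluation at \<open>v\<close>, so its contact carries over by
  linearity.\<close>

lemma vanishing_order_force_defect:
  assumes M1: "smooth_fdhs_family M1" and M2: "smooth_fdhs_family M2"
    and contact: "fdhs_contact_order r M1 M2"
  shows "vanishing_order (Suc r) (\<lambda>w. force_defect M2 v w - force_defect M1 v w)"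
proof -
  let ?W = "fdom M1 \<inter> fdom M2"
  have W: "open ?W" "UNIV \<times> {0} \<subseteq> ?W"
    using M1 M2 by (auto simp: smooth_fdhs_family_def)
  have contacts: "contact_order r (fdom M1) (ham M1) (fdom M2) (ham M2)"
    "contact_order r (fdom M1) (force M1) (fdom M2) (force M2)"
    using contact by (auto simp: fdhs_contact_order_def)
  have sm: "smooth_on (fdom M1) (ham M1)" "smooth_on (fdom M2) (ham M2)"
    using M1 M2 by (auto simp: smooth_fdhs_family_def)
  then have "smooth_on ?W (ham M1)" "smooth_on ?W (ham M2)"
    by (auto intro: smooth_on_subset)
  then have "smooth_on ?W (\<lambda>w. ham M2 w - ham M1 w)"
    unfolding smooth_on_def using Ck_on_diff[OF W(1)] by blast
  then have "vanishing_order (Suc r) (\<lambda>w. frechet_derivative (\<lambda>w. ham M2 w - ham M1 w) (at w) (v, 0))"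
    using contact_order_imp_vanishing_order[OF contacts(1)] by (rule vanishing_order_derivative[OF W])
  moreover have "vanishing_order (Suc r) (\<lambda>w. blinfun_apply (force M2 w - force M1 w) v)"
    using contact_order_imp_vanishing_order[OF contacts(2)]
    by (rule vanishing_order_linear[OF blinfun.bounded_linear_left])
  ultimately have "vanishing_order (Suc r) (\<lambda>w. frechet_derivative (\<lambda>w. ham M2 w - ham M1 w) (at w) (v, 0)
      - blinfun_apply (force M2 w - force M1 w) v)"
    by (rule vanishing_order_diff)
  \<comment> \<open>The derivative of the difference is split only where both Hamiltonians are known
    to be differentiable; a neighbourhood of the slice is enough.\<close>
  moreover have "frechet_derivative (\<lambda>w. ham M2 w - ham M1 w) (at w) (v, 0)
      - blinfun_apply (force M2 w - force M1 w) v = force_defect M2 v w - force_defect M1 v w"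
    if "w \<in> ?W" for w
  proof -
    have "((\<lambda>w. ham M2 w - ham M1 w) has_derivative
        (\<lambda>u. frechet_derivative (ham M2) (at w) u - frechet_derivative (ham M1) (at w) u)) (at w)"
      using that sm by (intro has_derivative_diff smooth_on_has_derivative[of "fdom _"]) auto
    from fun_cong[OF frechet_derivative_at[OF this], of "(v, 0)"] show ?thesis
      by (simp add: force_defect_def blinfun.diff_left)
  qed
  ultimately show ?thesis
    by (rule vanishing_order_cong[OF W, rotated])
qed

lemma smooth_on_minus_map:
  assumes "smooth_fdhs_family M"
  shows "smooth_on (fdom M) (minus_map M)"
proof -
  have W: "open (fdom M)"
    using assms by (simp add: smooth_fdhs_family_def)
  have "Ck_on k (fdom M) (\<lambda>w. (fst (fst w), \<Sum>b\<in>Basis. force_defect M (b, 0) w *\<^sub>R blinfun_inner_left b))" for k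
    by (intro Ck_on_Pair Ck_on_sum Ck_on_linear_compose[OF bounded_linear_scaleR_left]
        Ck_on_force_defect assms W
        Ck_on_bounded_linear bounded_linear_compose[OF bounded_linear_fst bounded_linear_fst])
  then show ?thesis
    unfolding smooth_on_def by (simp add: Ck_on_cong[OF W minus_map_eq[OF assms]])
qed

lemma smooth_on_plus_map:
  assumes "smooth_fdhs_family M"
  shows "smooth_on (fdom M) (plus_map M)"
proof -
  have W: "open (fdom M)"
    using assms by (simp add: smooth_fdhs_family_def)
  have "Ck_on k (fdom M) (\<lambda>w. (\<Sum>b\<in>Basis. force_defect M (0, blinfun_inner_left b) w *\<^sub>R b, snd (fst w)))" for k
    by (intro Ck_on_Pair Ck_on_sum Ck_on_linear_compose[OF bounded_linear_scaleR_left]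
        Ck_on_force_defect assms W
        Ck_on_bounded_linear bounded_linear_compose[OF bounded_linear_snd bounded_linear_fst])
  then show ?thesis
    unfolding smooth_on_def by (simp add: Ck_on_cong[OF W plus_map_eq[OF assms]])
qed

text \<open>The base points cancel, so the difference is a combination of fixed vectors with
  differences of force defects as coefficients.\<close>

lemma vanishing_order_minus_map:
  assumes M1: "smooth_fdhs_family M1" and M2: "smooth_fdhs_family M2"
    and contact: "fdhs_contact_order r M1 M2"
  shows "vanishing_order (Suc r) (\<lambda>w. minus_map M2 w - minus_map M1 w)"
proof (rule vanishing_order_cong)
  show "open (fdom M1 \<inter> fdom M2)" "UNIV \<times> {0} \<subseteq> fdom M1 \<inter> fdom M2"
    using M1 M2 by (auto simp: smooth_fdhs_family_def)
  have "bounded_linear (\<lambda>s. (0 :: 'a, s *\<^sub>R blinfun_inner_left b :: 'a dual))" for b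
    by (intro bounded_linear_Pair bounded_linear_zero bounded_linear_scaleR_left)
  then show "vanishing_order (Suc r) (\<lambda>w. \<Sum>b\<in>Basis.
      (0 :: 'a, (force_defect M2 (b, 0) w - force_defect M1 (b, 0) w) *\<^sub>R blinfun_inner_left b))"
    by (intro vanishing_order_sum vanishing_order_linear[OF _ vanishing_order_force_defect[OF assms]])
  show "(\<Sum>b\<in>Basis. (0 :: 'a, (force_defect M2 (b, 0) w - force_defect M1 (b, 0) w) *\<^sub>R blinfun_inner_left b))
      = minus_map M2 w - minus_map M1 w" if "w \<in> fdom M1 \<inter> fdom M2" for w
    using that M1 M2
    by (simp add: minus_map_eq prod_eq_iff fst_sum snd_sum scaleR_diff_left sum_subtractf)
qed

lemma vanishing_order_plus_map:
  assumes M1: "smooth_fdhs_family M1" and M2: "smooth_fdhs_family M2"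
    and contact: "fdhs_contact_order r M1 M2"
  shows "vanishing_order (Suc r) (\<lambda>w. plus_map M2 w - plus_map M1 w)"
proof (rule vanishing_order_cong)
  show "open (fdom M1 \<inter> fdom M2)" "UNIV \<times> {0} \<subseteq> fdom M1 \<inter> fdom M2"
    using M1 M2 by (auto simp: smooth_fdhs_family_def)
  have "bounded_linear (\<lambda>s. (s *\<^sub>R b :: 'a, 0 :: 'a dual))" for b
    by (intro bounded_linear_Pair bounded_linear_zero bounded_linear_scaleR_left)
  then show "vanishing_order (Suc r) (\<lambda>w. \<Sum>b\<in>Basis.
      ((force_defect M2 (0, blinfun_inner_left b) w
        - force_defect M1 (0, blinfun_inner_left b) w) *\<^sub>R b, 0 :: 'a dual))"
    by (intro vanishing_order_sum vanishing_order_linear[OF _ vanishing_order_force_defect[OF assms]])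
  show "(\<Sum>b\<in>Basis. ((force_defect M2 (0, blinfun_inner_left b) w
        - force_defect M1 (0, blinfun_inner_left b) w) *\<^sub>R b, 0 :: 'a dual))
      = plus_map M2 w - plus_map M1 w" if "w \<in> fdom M1 \<inter> fdom M2" for w
    using that M1 M2
    by (simp add: plus_map_eq prod_eq_iff fst_sum snd_sum scaleR_diff_left sum_subtractf)
qed

section \<open>Discrete flows\<close>

lemma lifted_minus_eq: "lifted_minus M = (\<lambda>w. (minus_map M w, snd w))"
  by (simp add: lifted_minus_def minus_map_def case_prod_unfold)

lemma inversion_nbhd_exists:
  assumes "smooth_fdhs_family M" "diffeo_between UNIV UNIV (fam_legendre_minus M 0)"
  shows "\<exists>U. inversion_nbhd M U"
  unfolding inversion_nbhd_def lifted_minus_eq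
proof (rule suspension_diffeo)
  show "diffeo_between UNIV UNIV (\<lambda>x. minus_map M (x, 0))"
    using assms(2) by (simp add: minus_map_def)
qed (use assms(1) in \<open>auto simp: smooth_fdhs_family_def smooth_on_minus_map\<close>)

text \<open>The flow takes \<open>h\<close> from its argument, \<open>plus_map\<close> takes it from
  the preimage. They agree because \<open>lifted_minus\<close> preserves \<open>h\<close>, but only
  on \<open>flow_dom\<close>, where the inverse is meaningful.\<close>

lemma discrete_flow_eq:
  assumes "w \<in> flow_dom M U"
  shows "discrete_flow M U w = plus_map M (inv_into U (lifted_minus M) w)"
proof -
  have "lifted_minus M (inv_into U (lifted_minus M) w) = w"
    using assms unfolding flow_dom_def by (rule f_inv_into_f)
  then have "snd (inv_into U (lifted_minus M) w) = snd w"
    by (metis lifted_minus_eq snd_conv)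
  then show ?thesis
    by (simp add: discrete_flow_def plus_map_def case_prod_unfold)
qed

lemma continuous_on_discrete_flow:
  assumes M: "smooth_fdhs_family M" and U: "inversion_nbhd M U"
  shows "continuous_on (flow_dom M U) (discrete_flow M U)"
proof -
  have "continuous_on (flow_dom M U) (inv_into U (lifted_minus M))"
    using U by (simp add: inversion_nbhd_def diffeo_between_def flow_dom_def smooth_on_continuous)
  moreover have "inv_into U (lifted_minus M) w \<in> fdom M" if "w \<in> flow_dom M U" for w
    using U inv_into_into[OF that[unfolded flow_dom_def]] by (auto simp: inversion_nbhd_def)
  ultimately have "continuous_on (flow_dom M U) (\<lambda>w. plus_map M (inv_into U (lifted_minus M) w))"
    by (intro continuous_on_compose2[OF smooth_on_continuous[OF smooth_on_plus_map[OF M]]]) auto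
  then show ?thesis
    by (rule continuous_on_eq) (simp add: discrete_flow_eq)
qed

text \<open>\<open>vanishing_order\<close> depends only on the germ along the slice, so the two
  inversion neighbourhoods may be chosen independently.\<close>

lemma contact_order_discrete_flow:
  assumes M1: "smooth_fdhs_family M1" and M2: "smooth_fdhs_family M2"
    and contact: "fdhs_contact_order r M1 M2"
    and U1: "inversion_nbhd M1 U1" and U2: "inversion_nbhd M2 U2"
  shows "contact_order r (flow_dom M1 U1) (discrete_flow M1 U1) (flow_dom M2 U2) (discrete_flow M2 U2)"
proof (rule vanishing_order_imp_contact_order)
  show dom: "open (flow_dom M1 U1)" "UNIV \<times> {0} \<subseteq> flow_dom M1 U1"
    "open (flow_dom M2 U2)" "UNIV \<times> {0} \<subseteq> flow_dom M2 U2"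
    using U1 U2 by (simp_all add: inversion_nbhd_def diffeo_between_def flow_dom_def)
  show "continuous_on (flow_dom M1 U1) (discrete_flow M1 U1)"
    "continuous_on (flow_dom M2 U2) (discrete_flow M2 U2)"
    using assms continuous_on_discrete_flow by blast+
  have "vanishing_order (Suc r) (\<lambda>w. plus_map M2 (inv_into U2 (lifted_minus M2) w)
      - plus_map M1 (inv_into U1 (lifted_minus M1) w))"
    unfolding lifted_minus_eq
  proof (rule vanishing_order_compose_inverse)
    show "smooth_on U1 (plus_map M1)"
      using U1 by (intro smooth_on_subset[OF smooth_on_plus_map[OF M1]]) (simp add: inversion_nbhd_def)
  qed (use U1 U2 vanishing_order_minus_map[OF M1 M2 contact] vanishing_order_plus_map[OF M1 M2 contact]
      in \<open>simp_all add: inversion_nbhd_def lifted_minus_eq\<close>)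
  then show "vanishing_order (Suc r) (\<lambda>w. discrete_flow M2 U2 w - discrete_flow M1 U1 w)"
    by (rule vanishing_order_cong[of "flow_dom M1 U1 \<inter> flow_dom M2 U2", rotated 3])
      (use dom in \<open>auto simp: discrete_flow_eq\<close>)
qed

text \<open>The existence clauses ensure that the statement about all inversion neighbourhoods is
  not vacuous.\<close>

theorem theorem6p10:
  fixes M1 M2 :: "'a::euclidean_space fdhs_family"
    and r :: nat
  assumes "smooth_fdhs_family M1" and "smooth_fdhs_family M2"
    and "diffeo_between UNIV UNIV (fam_legendre_plus M1 0)"
    and "diffeo_between UNIV UNIV (fam_legendre_minus M1 0)"
    and "diffeo_between UNIV UNIV (fam_legendre_plus M2 0)"
    and "diffeo_between UNIV UNIV (fam_legendre_minus M2 0)"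
    and "fdhs_contact_order r M1 M2"
  shows "(\<exists>U1. inversion_nbhd M1 U1) \<and> (\<exists>U2. inversion_nbhd M2 U2) \<and>
    (\<forall>U1 U2. inversion_nbhd M1 U1 \<longrightarrow> inversion_nbhd M2 U2 \<longrightarrow>
       contact_order r (flow_dom M1 U1) (discrete_flow M1 U1) (flow_dom M2 U2) (discrete_flow M2 U2))"
  using inversion_nbhd_exists[OF assms(1,4)] inversion_nbhd_exists[OF assms(2,6)]
    contact_order_discrete_flow[OF assms(1,2,7)] by blast

end
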